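(* i) In the Metropolis case, that is when $\rho(x,y)=\gamma\Big(\frac{\pi(y)Q(y,x)}{\pi(x)Q(x,y)}\Big)$ for all $x,y\in E$ with $Q(x,y)>0$, with $\gamma(u)=\min(1,u)$, it may happen that $\sigma(f,f)^2>\sigma(f)^2$; i.e. there exist a finite set $E$, a probability measure $\pi$, a selection matrix $Q$ and a function $f:E\to\mathbb R$ for which, with this $\rho$, $\sigma(f,f)^2>\sigma(f)^2$. ii) When $\rho(x,y)=\gamma\Big(\frac{\pi(y)Q(y,x)}{\pi(x)Q(x,y)}\Big)$ for all $x,y\in E$ with $Q(x,y)>0$, with $\gamma(u)=\frac{\alpha u}{1+u}$ for some $\alpha\in(0,2)$, then $\sigma(f,f)^2\le\sigma(f)^2$ for every real function $f$ on $E$. Furthermore, for $f$ non constant, the function $b\mapsto\sigma(f,bf)^2$ (on $\mathbb R$) is minimal at $$b_\star=\frac{\langle\pi,f^2\rangle-\langle\pi,f\rangle^2}{\langle\pi,f^2-fPf\rangle}$$ and $b_\star\ge 1/\alpha$. When $\alpha=1$, if, moreover, $\sigma(f,f)^2>0$, then $b_\star>1$.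
   Context: Let $E$ be a finite set and $\pi$ a probability measure on $E$ with $\pi(x)>0$ for all $x\in E$; write $\langle\pi,h\rangle=\sum_{x\in E}\pi(x)h(x)$. The selection matrix $Q$ is an irreducible transition matrix on $E$ such that for all $x,y\in E$, $Q(x,y)=0$ implies $Q(y,x)=0$. For $x,y\in E$ with $Q(x,y)>0$, the acceptance probabilities $(\rho(x,y),\rho(y,x))\in(0,1]^2$ satisfy $\rho(x,y)\pi(x)Q(x,y)=\rho(y,x)\pi(y)Q(y,x)$ (in particular in ii) $\alpha$ is such that the resulting $\rho$ takes values in $(0,1]$). Metropolis-Hastings chain: given $X_0,\dots,X_n$, the proposal $\tilde X_{n+1}$ is distributed according to $Q(X_n,\cdot)$; with probability $\rho(X_n,\tilde X_{n+1})$, $X_{n+1}=\tilde X_{n+1}$, otherwise $X_{n+1}=X_n$. The chain has transition matrix $P(x,y)=Q(x,y)\rho(x,y)$ for $x\ne y$, $P(x,x)=1-\sum_{z\ne x}P(x,z)$, and is reversible with respect to $\pi$. Write $Ph(x)=\sum_yP(x,y)h(y)$; $\mathbb E_\pi$ is expectation when $X_0$ has law $\pi$. For $f:E\to\mathbb R$, let $F$ be the solution (unique up to an additive constant) of the Poisson equation $F-PF=f-\langle\pi,f\rangle$, and set $\sigma(f)^2=\langle\pi,F^2\rangle-\langle\pi,(PF)^2\rangle$. This is the asymptotic variance of $I_n(f)=\frac1n\sum_{k=1}^nf(X_k)$. For $\psi:E\to\mathbb R$, $\sigma(f,\psi)^2$ is the asymptotic variance (variance of the Gaussian limit of $\sqrt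 n(\cdot-\langle\pi,f\rangle)$) of $$I_n(f,\psi)=I_n(f)+\frac1n\sum_{k=0}^{n-1}\Big(\rho(X_k,\tilde X_{k+1})\psi(\tilde X_{k+1})+(1-\rho(X_k,\tilde X_{k+1}))\psi(X_k)-\psi(X_{k+1})\Big),$$ which is given by $$\sigma(f,\psi)^2=\sigma(f)^2-\mathbb E_\pi\Big[(1-\rho(X_0,X_1))(F(X_1)-F(X_0))^2\Big]+\mathbb E_\pi\Big[(1-\rho(X_0,X_1))\big(\psi(X_1)-F(X_1)-\psi(X_0)+F(X_0)\big)^2\Big].$$ *)

theory Defs
  imports "HOL-Probability.Probability"
begin

text \<open>
  The state space is an explicit finite carrier \<open>E\<close>.  A transition matrix on \<open>E\<close> is a map
  \<open>Q :: 'a \<Rightarrow> 'a pmf\<close> whose rows \<open>Q x\<close>, for \<open>x \<in> E\<close>, are supported in \<open>E\<close>; values of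
  \<open>Q\<close>, \<open>\<rho>\<close> and of test functions outside \<open>E\<close> are irrelevant throughout.
\<close>

definition irreducible_on :: "'a set \<Rightarrow> ('a \<Rightarrow> 'a pmf) \<Rightarrow> bool" where
  "irreducible_on E Q \<longleftrightarrow>
     (\<forall>x\<in>E. \<forall>y\<in>E. (x, y) \<in> {(u, v). u \<in> E \<and> v \<in> E \<and> pmf (Q u) v > 0}\<^sup>*)"

text \<open>Standing assumptions; \<open>set_pmf \<pi> = E\<close> says that \<open>\<pi>\<close> lives on \<open>E\<close> and charges every point.\<close>

definition metropolis_hastings ::
    "'a set \<Rightarrow> 'a pmf \<Rightarrow> ('a \<Rightarrow> 'a pmf) \<Rightarrow> ('a \<Rightarrow> 'a \<Rightarrow> real) \<Rightarrow> bool" where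
  "metropolis_hastings E \<pi> Q \<rho> \<longleftrightarrow>
     finite E \<and> set_pmf \<pi> = E \<and>
     (\<forall>x\<in>E. set_pmf (Q x) \<subseteq> E) \<and>
     irreducible_on E Q \<and>
     (\<forall>x\<in>E. \<forall>y\<in>E. pmf (Q x) y = 0 \<longrightarrow> pmf (Q y) x = 0) \<and>
     (\<forall>x\<in>E. \<forall>y\<in>E. pmf (Q x) y > 0 \<longrightarrow>
        0 < \<rho> x y \<and> \<rho> x y \<le> 1 \<and> 0 < \<rho> y x \<and> \<rho> y x \<le> 1 \<and>
        \<rho> x y * pmf \<pi> x * pmf (Q x) y = \<rho> y x * pmf \<pi> y * pmf (Q y) x)"

definition acceptance_given_by ::
    "(real \<Rightarrow> real) \<Rightarrow> 'a set \<Rightarrow> 'a pmf \<Rightarrow> ('a \<Rightarrow> 'a pmf) \<Rightarrow> ('a \<Rightarrow> 'a \<Rightarrow> real) \<Rightarrow> bool" where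
  "acceptance_given_by \<gamma> E \<pi> Q \<rho> \<longleftrightarrow>
     (\<forall>x\<in>E. \<forall>y\<in>E. pmf (Q x) y > 0 \<longrightarrow>
        \<rho> x y = \<gamma> ((pmf \<pi> y * pmf (Q y) x) / (pmf \<pi> x * pmf (Q x) y)))"

definition mean :: "'a set \<Rightarrow> 'a pmf \<Rightarrow> ('a \<Rightarrow> real) \<Rightarrow> real" where
  "mean E \<pi> h = (\<Sum>x\<in>E. pmf \<pi> x * h x)"

definition mh_matrix ::
    "'a set \<Rightarrow> ('a \<Rightarrow> 'a pmf) \<Rightarrow> ('a \<Rightarrow> 'a \<Rightarrow> real) \<Rightarrow> 'a \<Rightarrow> 'a \<Rightarrow> real" where
  "mh_matrix E Q \<rho> x y =
     (if x \<noteq> y then pmf (Q x) y * \<rho> x y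
      else 1 - (\<Sum>z\<in>E - {x}. pmf (Q x) z * \<rho> x z))"

definition mh_op ::
    "'a set \<Rightarrow> ('a \<Rightarrow> 'a pmf) \<Rightarrow> ('a \<Rightarrow> 'a \<Rightarrow> real) \<Rightarrow> ('a \<Rightarrow> real) \<Rightarrow> 'a \<Rightarrow> real" where
  "mh_op E Q \<rho> h x = (\<Sum>y\<in>E. mh_matrix E Q \<rho> x y * h y)"

text \<open>The solution is unique on \<open>E\<close> only up to an additive constant, which does not affect \<open>sigma2\<close>.\<close>

definition poisson_solution ::
    "'a set \<Rightarrow> 'a pmf \<Rightarrow> ('a \<Rightarrow> 'a pmf) \<Rightarrow> ('a \<Rightarrow> 'a \<Rightarrow> real) \<Rightarrow> ('a \<Rightarrow> real) \<Rightarrow> 'a \<Rightarrow> real" where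
  "poisson_solution E \<pi> Q \<rho> f =
     (SOME F. \<forall>x\<in>E. F x - mh_op E Q \<rho> F x = f x - mean E \<pi> f)"

definition sigma2 ::
    "'a set \<Rightarrow> 'a pmf \<Rightarrow> ('a \<Rightarrow> 'a pmf) \<Rightarrow> ('a \<Rightarrow> 'a \<Rightarrow> real) \<Rightarrow> ('a \<Rightarrow> real) \<Rightarrow> real" where
  "sigma2 E \<pi> Q \<rho> f =
     (let F = poisson_solution E \<pi> Q \<rho> f
      in mean E \<pi> (\<lambda>x. (F x)\<^sup>2) - mean E \<pi> (\<lambda>x. (mh_op E Q \<rho> F x)\<^sup>2))"

text \<open>One step from \<open>x\<close>: the pair (proposal, next state).\<close>

definition mh_step ::
    "('a \<Rightarrow> 'a pmf) \<Rightarrow> ('a \<Rightarrow> 'a \<Rightarrow> real) \<Rightarrow> 'a \<Rightarrow> ('a \<times> 'a) pmf" where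
  "mh_step Q \<rho> x =
     do { y \<leftarrow> Q x;
          accept \<leftarrow> bernoulli_pmf (\<rho> x y);
          return_pmf (y, if accept then y else x) }"

text \<open>
  Joint law of the chain \<open>X\<close> and the proposals \<open>Xt\<close> up to time \<open>n\<close>, started from \<open>\<nu>\<close>.  Only
  \<open>X 0, \<dots>, X n\<close> and \<open>Xt 1, \<dots>, Xt n\<close> are meaningful; the other coordinates are fillers.
\<close>

primrec mh_chain ::
    "'a pmf \<Rightarrow> ('a \<Rightarrow> 'a pmf) \<Rightarrow> ('a \<Rightarrow> 'a \<Rightarrow> real) \<Rightarrow> nat \<Rightarrow> ((nat \<Rightarrow> 'a) \<times> (nat \<Rightarrow> 'a)) pmf" where
  "mh_chain \<nu> Q \<rho> 0 = map_pmf (\<lambda>x. (\<lambda>_. x, \<lambda>_. x)) \<nu>"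
| "mh_chain \<nu> Q \<rho> (Suc n) =
     do { (X, Xt) \<leftarrow> mh_chain \<nu> Q \<rho> n;
          (y, z) \<leftarrow> mh_step Q \<rho> (X n);
          return_pmf (X(Suc n := z), Xt(Suc n := y)) }"

definition wr_estimator ::
    "('a \<Rightarrow> 'a \<Rightarrow> real) \<Rightarrow> ('a \<Rightarrow> real) \<Rightarrow> ('a \<Rightarrow> real) \<Rightarrow> nat \<Rightarrow> (nat \<Rightarrow> 'a) \<times> (nat \<Rightarrow> 'a) \<Rightarrow> real" where
  "wr_estimator \<rho> f \<psi> n = (\<lambda>(X, Xt).
     (\<Sum>k=1..n. f (X k)) / real n +
     (\<Sum>k<n. \<rho> (X k) (Xt (Suc k)) * \<psi> (Xt (Suc k)) +
             (1 - \<rho> (X k) (Xt (Suc k))) * \<psi> (X k) - \<psi> (X (Suc k))) / real n)"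

text \<open>
  \<open>v\<close> is the variance of the Gaussian limit of \<open>sqrt n * (I_n(f,\<psi>) - <\<pi>,f>)\<close>, whatever the
  initial law \<open>\<nu>\<close> on \<open>E\<close>.  The limit \<open>N(0,v)\<close> is written as the law of \<open>sqrt v * Z\<close> with
  \<open>Z\<close> standard normal, so that the degenerate case \<open>v = 0\<close> (Dirac mass at 0) is included;
  \<open>0 \<le> v\<close> is needed because \<open>sqrt (- v) = - sqrt v\<close>.
\<close>

definition is_wr_variance ::
    "'a set \<Rightarrow> 'a pmf \<Rightarrow> ('a \<Rightarrow> 'a pmf) \<Rightarrow> ('a \<Rightarrow> 'a \<Rightarrow> real) \<Rightarrow>
     ('a \<Rightarrow> real) \<Rightarrow> ('a \<Rightarrow> real) \<Rightarrow> real \<Rightarrow> bool" where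
  "is_wr_variance E \<pi> Q \<rho> f \<psi> v \<longleftrightarrow>
     0 \<le> v \<and>
     (\<forall>\<nu>. set_pmf \<nu> \<subseteq> E \<longrightarrow>
        weak_conv_m
          (\<lambda>n. distr (measure_pmf (mh_chain \<nu> Q \<rho> n)) borel
                 (\<lambda>\<omega>. sqrt (real n) * (wr_estimator \<rho> f \<psi> n \<omega> - mean E \<pi> f)))
          (distr std_normal_distribution borel (\<lambda>z. sqrt v * z)))"

definition wr_sigma2 ::
    "'a set \<Rightarrow> 'a pmf \<Rightarrow> ('a \<Rightarrow> 'a pmf) \<Rightarrow> ('a \<Rightarrow> 'a \<Rightarrow> real) \<Rightarrow>
     ('a \<Rightarrow> real) \<Rightarrow> ('a \<Rightarrow> real) \<Rightarrow> real" where
  "wr_sigma2 E \<pi> Q \<rho> f \<psi> = (THE v. is_wr_variance E \<pi> Q \<rho> f \<psi> v)"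

end

(* Up to the coboundary of P F, the estimator is a normalised sum of martingale increments.  The
characteristic function of that sum is an iterate of the twisted operator
T_s h x = E_x[exp (i s U) h(X_1)], and a corrector built from a second Poisson equation gives an
eigenfunction of T_s up to O(s^3); Levy's continuity theorem then yields the central limit theorem.
The asymptotic variance splits as sigma^2(f) - V(F) + V(psi - F), where
V(g) = E_pi[(1 - rho(X_0, X_1)) (g(X_1) - g(X_0))^2].

For gamma(u) = alpha u / (1 + u) one has rho(x,y) + rho(y,x) = alpha, so V is (2 - alpha) times the
Dirichlet form and sigma^2(f, b f) is a quadratic polynomial in b.  Everything then follows from
<f, f - P f> <= alpha Var(f); for alpha = 1, equality forces P f to be constant and hence
sigma^2(f, f) = 0.  In the Metropolis case V only sees the edges with asymmetric flux, so a function F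
constant across these edges, with P F not constant there, gives the counterexample f = F - P F. *)
theory Submission
  imports Defs "Jordan_Normal_Form.Determinant" "HOL-Real_Asymp.Real_Asymp"
begin

section \<open>Reversibility and the Poisson equation\<close>

text \<open>For a square system injectivity forces surjectivity. An enumeration of \<open>E\<close>
  carries the system to matrices, where a trivial kernel gives a nonzero determinant and hence a
  right inverse.\<close>

lemma finite_linear_system_solvable:
  fixes A :: "'a \<Rightarrow> 'a \<Rightarrow> real"
  assumes fin: "finite E"
    and inj: "\<And>h. (\<And>x. x \<in> E \<Longrightarrow> (\<Sum>y\<in>E. A x y * h y) = 0) \<Longrightarrow> (\<And>x. x \<in> E \<Longrightarrow> h x = 0)"
  shows "\<exists>h. \<forall>x\<in>E. (\<Sum>y\<in>E. A x y * h y) = g x"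
proof -
  define n where "n = card E"
  obtain e where e: "bij_betw e {0..<n} E"
    using ex_bij_betw_nat_finite[OF fin] n_def by blast
  define e' where "e' = the_inv_into {0..<n} e"
  have e'e: "e' (e i) = i" if "i < n" for i
    using e that unfolding e'_def bij_betw_def by (simp add: the_inv_into_f_f)
  have eE: "e i \<in> E" if "i < n" for i
    using e that bij_betwE by fastforce
  have ex: "\<exists>i<n. x = e i" if "x \<in> E" for x
    using e that unfolding bij_betw_def by auto
  have sum_e: "(\<Sum>y\<in>E. u y) = (\<Sum>i<n. u (e i))" for u :: "'a \<Rightarrow> real"
    using sum.reindex_bij_betw[OF e, of u] by (simp add: atLeast0LessThan)
  define M where "M = mat n n (\<lambda>(i, j). A (e i) (e j))"
  have M: "M \<in> carrier_mat n n" by (simp add: M_def)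
  have M_apply: "vec_index (M *\<^sub>v v) i = (\<Sum>y\<in>E. A (e i) y * vec_index v (e' y))"
    if "i < n" "v \<in> carrier_vec n" for i v
    using that by (simp add: M_def scalar_prod_def sum_e e'e atLeast0LessThan)
  have "det M \<noteq> 0"
  proof
    assume "det M = 0"
    then obtain v where v: "v \<in> carrier_vec n" "v \<noteq> 0\<^sub>v n" "M *\<^sub>v v = 0\<^sub>v n"
      using det_0_iff_vec_prod_zero[OF M] by blast
    have "vec_index v (e' x) = 0" if "x \<in> E" for x
    proof (rule inj[of "\<lambda>x. vec_index v (e' x)", OF _ that])
      fix x assume "x \<in> E"
      then obtain i where "i < n" "x = e i" using ex by blast
      then show "(\<Sum>y\<in>E. A x y * vec_index v (e' y)) = 0"
        using M_apply[of i v] v by simp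
    qed
    then have "vec_index v i = 0" if "i < n" for i
      using eE[OF that] e'e[OF that] by metis
    then have "v = 0\<^sub>v n" using v(1) by auto
    then show False using v(2) by simp
  qed
  \<comment> \<open>Invertibility is obtained as being a unit of the matrix ring; \<open>()\<close>
    only fills the extension field of the ring record.\<close>
  from det_non_zero_imp_unit[OF M this, of "()"]
  obtain B where B: "B \<in> carrier_mat n n" "M * B = 1\<^sub>m n"
    by (auto simp: Units_def ring_mat_def)
  define b where "b = vec n (\<lambda>i. g (e i))"
  have b: "b \<in> carrier_vec n" by (simp add: b_def)
  have sol: "M *\<^sub>v (B *\<^sub>v b) = b"
    using assoc_mult_mat_vec[OF M B(1) b] B(2) b by simp
  show ?thesis
  proof (intro exI ballI)
    fix x assume "x \<in> E"
    then obtain i where i: "i < n" "x = e i" using ex by blast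
    have "B *\<^sub>v b \<in> carrier_vec n" using B(1) b by simp
    from M_apply[OF i(1) this] have "(\<Sum>y\<in>E. A x y * vec_index (B *\<^sub>v b) (e' y)) = vec_index b i"
      unfolding sol i(2) by simp
    also have "\<dots> = g x" using i by (simp add: b_def)
    finally show "(\<Sum>y\<in>E. A x y * vec_index (B *\<^sub>v b) (e' y)) = g x" .
  qed
qed

section \<open>The transition operator and its generator\<close>

locale mh =
  fixes E :: "'a set" and \<pi> :: "'a pmf" and Q :: "'a \<Rightarrow> 'a pmf" and \<rho> :: "'a \<Rightarrow> 'a \<Rightarrow> real"
  assumes mh: "metropolis_hastings E \<pi> Q \<rho>"
begin

abbreviation P where "P \<equiv> mh_op E Q \<rho>"
abbreviation avg where "avg \<equiv> mean E \<pi>"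

lemma finE [simp]: "finite E"
  using mh unfolding metropolis_hastings_def by blast

lemma set_pi: "set_pmf \<pi> = E"
  using mh unfolding metropolis_hastings_def by blast

lemma pi_pos: "x \<in> E \<Longrightarrow> 0 < pmf \<pi> x"
  using set_pi pmf_positive by metis

lemma E_nonempty: "E \<noteq> {}"
  using set_pi set_pmf_not_empty by metis

lemma sum_pi: "(\<Sum>x\<in>E. pmf \<pi> x) = 1"
  using set_pi by (simp add: sum_pmf_eq_1)

lemma set_Q: "x \<in> E \<Longrightarrow> set_pmf (Q x) \<subseteq> E"
  using mh unfolding metropolis_hastings_def by blast

lemma sum_Q: "x \<in> E \<Longrightarrow> (\<Sum>y\<in>E. pmf (Q x) y) = 1"
  using set_Q by (simp add: sum_pmf_eq_1)

lemma Q_zero_sym: "x \<in> E \<Longrightarrow> y \<in> E \<Longrightarrow> pmf (Q x) y = 0 \<longleftrightarrow> pmf (Q y) x = 0"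
  using mh unfolding metropolis_hastings_def by blast

lemma rho_bounds:
  assumes "x \<in> E" "y \<in> E" "pmf (Q x) y \<noteq> 0"
  shows "0 < \<rho> x y" "\<rho> x y \<le> 1"
proof -
  have "pmf (Q x) y > 0" using assms(3) by (simp add: pmf_nonneg order.strict_iff_order)
  then show "0 < \<rho> x y" "\<rho> x y \<le> 1"
    using mh assms unfolding metropolis_hastings_def by blast+
qed

text \<open>The edge conductance of the reversible chain. The diagonal value counts accepted
  proposals of the current state; it is harmless, since flux is always paired with differences that
  vanish there.\<close>

definition flux :: "'a \<Rightarrow> 'a \<Rightarrow> real" where
  "flux x y = pmf \<pi> x * pmf (Q x) y * \<rho> x y"

lemma flux_sym: "x \<in> E \<Longrightarrow> y \<in> E \<Longrightarrow> flux x y = flux y x"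
proof -
  assume *: "x \<in> E" "y \<in> E"
  show ?thesis
  proof (cases "pmf (Q x) y = 0")
    case True
    then show ?thesis using Q_zero_sym[OF *] by (simp add: flux_def)
  next
    case False
    then have "pmf (Q x) y > 0" by (simp add: pmf_nonneg order.strict_iff_order)
    then have "\<rho> x y * pmf \<pi> x * pmf (Q x) y = \<rho> y x * pmf \<pi> y * pmf (Q y) x"
      using mh * unfolding metropolis_hastings_def by blast
    then show ?thesis by (simp add: flux_def mult_ac)
  qed
qed

lemma flux_nonneg: "x \<in> E \<Longrightarrow> y \<in> E \<Longrightarrow> 0 \<le> flux x y"
  using rho_bounds[of x y] pi_pos[of x] by (cases "pmf (Q x) y = 0") (auto simp: flux_def)

lemma flux_pos: "x \<in> E \<Longrightarrow> y \<in> E \<Longrightarrow> pmf (Q x) y > 0 \<Longrightarrow> 0 < flux x y"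
  using rho_bounds[of x y] pi_pos[of x] by (simp add: flux_def)

text \<open>The rejection mass lumped into the diagonal entry of \<open>mh_matrix\<close> is
  returned to the proposals that were rejected. Sums then run over all of \<open>E\<close> without a
  case distinction, as expectations over proposal and acceptance.\<close>

lemma mh_op_eq:
  assumes "x \<in> E"
  shows "P h x = (\<Sum>y\<in>E. pmf (Q x) y * (\<rho> x y * h y + (1 - \<rho> x y) * h x))"
proof -
  have "P h x = mh_matrix E Q \<rho> x x * h x + (\<Sum>y\<in>E-{x}. mh_matrix E Q \<rho> x y * h y)"
    unfolding mh_op_def by (rule sum.remove[OF finE assms])
  also have "(\<Sum>y\<in>E-{x}. mh_matrix E Q \<rho> x y * h y) = (\<Sum>y\<in>E-{x}. pmf (Q x) y * \<rho> x y * h y)"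
    by (intro sum.cong) (auto simp: mh_matrix_def)
  also have "mh_matrix E Q \<rho> x x * h x = h x - (\<Sum>y\<in>E-{x}. pmf (Q x) y * \<rho> x y * h x)"
    by (simp add: mh_matrix_def left_diff_distrib sum_distrib_right)
  finally have "P h x = h x + (\<Sum>y\<in>E-{x}. pmf (Q x) y * \<rho> x y * (h y - h x))"
    by (simp add: sum_subtractf right_diff_distrib)
  also have "(\<Sum>y\<in>E-{x}. pmf (Q x) y * \<rho> x y * (h y - h x)) = (\<Sum>y\<in>E. pmf (Q x) y * \<rho> x y * (h y - h x))"
    by (subst sum.remove[OF finE assms]) simp
  also have "h x + \<dots> = (\<Sum>y\<in>E. pmf (Q x) y) * h x + \<dots>"
    using sum_Q[OF assms] by simp
  also have "\<dots> = (\<Sum>y\<in>E. pmf (Q x) y * (\<rho> x y * h y + (1 - \<rho> x y) * h x))"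
    unfolding sum_distrib_right sum.distrib[symmetric]
    by (intro sum.cong refl) (simp add: algebra_simps)
  finally show ?thesis .
qed

lemma pi_generator:
  assumes "x \<in> E"
  shows "pmf \<pi> x * (h x - P h x) = (\<Sum>y\<in>E. flux x y * (h x - h y))"
proof -
  have "h x - P h x = (\<Sum>y\<in>E. pmf (Q x) y) * h x - P h x"
    using sum_Q[OF assms] by simp
  also have "\<dots> = (\<Sum>y\<in>E. pmf (Q x) y * \<rho> x y * (h x - h y))"
    unfolding mh_op_eq[OF assms] sum_distrib_right sum_subtractf[symmetric]
    by (intro sum.cong) (auto simp: algebra_simps)
  finally show ?thesis
    by (simp add: flux_def sum_distrib_left mult_ac)
qed

lemma mean_add: "avg (\<lambda>x. g x + h x) = avg g + avg h"
  by (simp add: mean_def sum.distrib distrib_left)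

lemma mean_diff: "avg (\<lambda>x. g x - h x) = avg g - avg h"
  by (simp add: mean_def sum_subtractf right_diff_distrib)

lemma mean_cmult: "avg (\<lambda>x. c * h x) = c * avg h"
  by (simp add: mean_def sum_distrib_left mult_ac)

lemma mean_const: "avg (\<lambda>x. c) = c"
  by (simp add: mean_def sum_pi flip: sum_distrib_right)

lemma mean_cong: "(\<And>x. x \<in> E \<Longrightarrow> g x = h x) \<Longrightarrow> avg g = avg h"
  by (simp add: mean_def)

section \<open>The Dirichlet form and the Poisson equation\<close>

definition dirichlet :: "('a \<Rightarrow> real) \<Rightarrow> ('a \<Rightarrow> real) \<Rightarrow> real" where
  "dirichlet g h = (\<Sum>x\<in>E. \<Sum>y\<in>E. flux x y * (g x - g y) * (h x - h y)) / 2"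

text \<open>Summation by parts: exchanging the two endpoints and using symmetry of the flux turns
  the one-sided sum into half of its symmetrised version. Self-adjointness of 1 - P follows, and g =
  1 gives invariance of \<pi>.\<close>

lemma mean_generator: "avg (\<lambda>x. g x * (h x - P h x)) = dirichlet g h"
proof -
  let ?S = "\<Sum>x\<in>E. \<Sum>y\<in>E. flux x y * g x * (h x - h y)"
  have "avg (\<lambda>x. g x * (h x - P h x)) = (\<Sum>x\<in>E. g x * (pmf \<pi> x * (h x - P h x)))"
    by (simp add: mean_def mult_ac)
  also have "\<dots> = ?S"
    by (intro sum.cong refl) (simp add: pi_generator sum_distrib_left mult_ac)
  finally have 1: "avg (\<lambda>x. g x * (h x - P h x)) = ?S" .
  have "?S = (\<Sum>y\<in>E. \<Sum>x\<in>E. flux x y * g x * (h x - h y))"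
    by (rule sum.swap)
  also have "\<dots> = (\<Sum>x\<in>E. \<Sum>y\<in>E. flux x y * g y * (h y - h x))"
    by (intro sum.cong refl) (simp add: flux_sym)
  finally have "2 * ?S = ?S + (\<Sum>x\<in>E. \<Sum>y\<in>E. flux x y * g y * (h y - h x))" by simp
  also have "\<dots> = (\<Sum>x\<in>E. \<Sum>y\<in>E. flux x y * (g x - g y) * (h x - h y))"
    unfolding sum.distrib[symmetric]
    by (intro sum.cong refl) (simp add: algebra_simps)
  also have "\<dots> = 2 * dirichlet g h" by (simp add: dirichlet_def)
  finally show ?thesis using 1 by simp
qed

lemma dirichlet_commute: "dirichlet g h = dirichlet h g"
  by (simp add: dirichlet_def mult_ac)

lemma mean_mh_op: "avg (P h) = avg h"
  using mean_generator[of "\<lambda>_. 1" h] by (simp add: dirichlet_def mean_diff)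

text \<open>A vanishing sum of nonnegative terms vanishes termwise. The flux is positive on every
  edge of \<open>Q\<close>, so \<open>h\<close> agrees across edges, and irreducibility carries this
  along paths.\<close>

lemma dirichlet_zero_imp_constant:
  assumes "dirichlet h h = 0" "x \<in> E" "y \<in> E"
  shows "h x = h y"
proof -
  have nn: "0 \<le> flux x y * (h x - h y) * (h x - h y)" if "x \<in> E" "y \<in> E" for x y
    using flux_nonneg[OF that] by (simp add: mult.assoc)
  have "(\<Sum>x\<in>E. \<Sum>y\<in>E. flux x y * (h x - h y) * (h x - h y)) = 0"
    using assms(1) by (simp add: dirichlet_def)
  then have z: "flux x y * (h x - h y) * (h x - h y) = 0" if "x \<in> E" "y \<in> E" for x y
    using that nn by (simp add: sum_nonneg_eq_0_iff sum_nonneg)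
  have step: "h u = h v" if "u \<in> E" "v \<in> E" "pmf (Q u) v > 0" for u v
    using z[OF that(1,2)] flux_pos[OF that] by simp
  have "(x, y) \<in> {(u, v). u \<in> E \<and> v \<in> E \<and> pmf (Q u) v > 0}\<^sup>*"
    using mh assms unfolding metropolis_hastings_def irreducible_on_def by blast
  then show ?thesis
    by (induction rule: rtrancl_induct) (auto dest: step)
qed

lemma dirichlet_nonneg: "0 \<le> dirichlet h h"
  unfolding dirichlet_def using flux_nonneg
  by (auto intro!: divide_nonneg_nonneg sum_nonneg simp: mult.assoc)

text \<open>Adding the projection onto constants to \<open>1 - P\<close> makes it invertible.\<close>

lemma poisson_solvable:
  assumes "avg g = 0"
  shows "\<exists>G. \<forall>x\<in>E. G x - P G x = g x"
proof -
  define A where "A x y = (if x = y then 1 else 0) - mh_matrix E Q \<rho> x y + pmf \<pi> y" for x y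
  have A: "(\<Sum>y\<in>E. A x y * h y) = h x - P h x + avg h" if "x \<in> E" for x h
  proof -
    have "(\<Sum>y\<in>E. A x y * h y)
        = (\<Sum>y\<in>E. (if x = y then h y else 0) - mh_matrix E Q \<rho> x y * h y + pmf \<pi> y * h y)"
      by (intro sum.cong refl) (simp add: A_def algebra_simps)
    then show ?thesis
      using that by (simp add: sum.distrib sum_subtractf mh_op_def mean_def)
  qed
  \<comment> \<open>By invariance 1 - P has mean zero, so averaging the equation reads off
    \<open>avg h\<close>. This serves twice: a kernel element has mean 0, and so does the solution
    for a centred \<open>g\<close>, which then solves the Poisson equation.\<close>
  have mean_A: "avg (\<lambda>x. h x - P h x + avg h) = avg h" for h
    by (simp add: mean_add mean_diff mean_mh_op mean_const)
  have "\<exists>h. \<forall>x\<in>E. (\<Sum>y\<in>E. A x y * h y) = g x"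
  proof (rule finite_linear_system_solvable)
    fix h x assume 0: "\<And>x. x \<in> E \<Longrightarrow> (\<Sum>y\<in>E. A x y * h y) = 0" and x: "x \<in> E"
    have 1: "h y - P h y + avg h = 0" if "y \<in> E" for y
      using 0[OF that] unfolding A[OF that] .
    have "avg h = avg (\<lambda>y. h y - P h y + avg h)" by (rule mean_A[symmetric])
    also have "\<dots> = avg (\<lambda>_. 0)" by (rule mean_cong[OF 1])
    finally have m: "avg h = 0" by (simp only: mean_const)
    have "h y * (h y - P h y) = 0" if "y \<in> E" for y
      using 1[OF that] m by simp
    from mean_cong[OF this] have "dirichlet h h = 0"
      unfolding mean_generator[symmetric] using mean_const[of 0] by simp
    then have "h y = h x" if "y \<in> E" for y
      using dirichlet_zero_imp_constant that x by blast
    then have "avg h = h x"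
      using mean_cong[of h "\<lambda>_. h x"] mean_const[of "h x"] by simp
    then show "h x = 0" using m by simp
  qed simp
  then obtain h where "\<forall>x\<in>E. (\<Sum>y\<in>E. A x y * h y) = g x" by blast
  then have h: "h x - P h x + avg h = g x" if "x \<in> E" for x
    using A[OF that, of h] that by auto
  have "avg h = avg (\<lambda>y. h y - P h y + avg h)" by (rule mean_A[symmetric])
  also have "\<dots> = avg g" by (rule mean_cong[OF h])
  finally have "avg h = 0" using assms by simp
  then show ?thesis using h by auto
qed

lemma poisson_solution:
  assumes "x \<in> E"
  shows "poisson_solution E \<pi> Q \<rho> f x - P (poisson_solution E \<pi> Q \<rho> f) x = f x - avg f"
proof -
  have "\<exists>F. \<forall>x\<in>E. F x - P F x = f x - avg f"
    by (rule poisson_solvable) (simp add: mean_diff mean_const)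
  from someI_ex[OF this] assms show ?thesis
    unfolding poisson_solution_def by blast
qed

end

section \<open>The central limit theorem\<close>

lemma expectation_bind_finite:
  fixes h :: "'b \<Rightarrow> 'c::{banach, second_countable_topology}"
  assumes "finite (set_pmf p)" "\<And>x. x \<in> set_pmf p \<Longrightarrow> finite (set_pmf (f x))"
  shows "measure_pmf.expectation (bind_pmf p f) h
       = measure_pmf.expectation p (\<lambda>x. measure_pmf.expectation (f x) h)"
  using assms by (simp add: pmf_expectation_bind[of "set_pmf p"] integral_measure_pmf[of "set_pmf p"])

lemma norm_expectation_le:
  fixes h :: "'b \<Rightarrow> 'c::{banach, second_countable_topology}"
  assumes "finite (set_pmf p)" "\<And>x. x \<in> set_pmf p \<Longrightarrow> norm (h x) \<le> B"
  shows "norm (measure_pmf.expectation p h) \<le> B"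
proof -
  have "norm (measure_pmf.expectation p h) \<le> measure_pmf.expectation p (\<lambda>x. norm (h x))"
    by (rule integral_norm_bound)
  also have "\<dots> \<le> measure_pmf.expectation p (\<lambda>_. B)"
    using assms by (intro integral_mono_AE integrable_measure_pmf_finite) (auto simp: AE_measure_pmf_iff)
  finally show ?thesis by simp
qed

lemma norm_iexp_minus_one: "cmod (iexp x - 1) \<le> \<bar>x\<bar>"
  using iexp_approx1[of x 0] by simp

lemma iexp_second_order: "cmod (iexp x - (1 + \<i> * x - x\<^sup>2 / 2)) \<le> \<bar>x\<bar> ^ 3 / 6"
proof -
  have "(\<Sum>k\<le>2. (\<i> * complex_of_real x) ^ k / fact k) = 1 + \<i> * x - x\<^sup>2 / 2"
    by (simp add: numeral_2_eq_2 power2_eq_square mult_ac)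
  moreover have "(fact (Suc 2) :: real) = 6" by (simp add: fact_numeral)
  ultimately show ?thesis
    using iexp_approx1[of x 2] by (simp add: eval_nat_numeral)
qed

text \<open>The linear term of the expansion drops out because X is centred, and g already carries
  the factor s^2, so it only meets iexp - 1 = O(s). The constant depends on the bounds K and L
  alone, which makes the estimate uniform over starting points.\<close>

lemma twisted_expectation_approx:
  fixes X g :: "'b \<Rightarrow> real"
  assumes fin: "finite (set_pmf p)"
    and mean_X: "measure_pmf.expectation p X = 0"
    and X: "\<And>x. x \<in> set_pmf p \<Longrightarrow> \<bar>X x\<bar> \<le> K"
    and g: "\<And>x. x \<in> set_pmf p \<Longrightarrow> \<bar>g x\<bar> \<le> L"
  shows "cmod (measure_pmf.expectation p (\<lambda>x. iexp (s * X x) * (1 + s\<^sup>2 * g x))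
          - of_real (1 - s\<^sup>2 * measure_pmf.expectation p (\<lambda>x. (X x)\<^sup>2) / 2
              + s\<^sup>2 * measure_pmf.expectation p g))
        \<le> (K ^ 3 / 6 + K * L) * \<bar>s\<bar> ^ 3"
proof -
  note int = integrable_measure_pmf_finite[OF fin]
  \<comment> \<open>The Taylor polynomial of degree 2 in s of the integrand, split into real and
    imaginary parts so that its expectation is immediate.\<close>
  define T where "T x = complex_of_real (1 - s\<^sup>2 * (X x)\<^sup>2 / 2 + s\<^sup>2 * g x) + \<i> * (s * X x)" for x
  have "measure_pmf.expectation p T
      = of_real (measure_pmf.expectation p (\<lambda>x. 1 - s\<^sup>2 * (X x)\<^sup>2 / 2 + s\<^sup>2 * g x))
        + \<i> * of_real (measure_pmf.expectation p (\<lambda>x. s * X x))"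
    unfolding T_def
    by (subst Bochner_Integration.integral_add[OF int int], subst integral_mult_right_zero,
        subst (1 2) integral_complex_of_real) (rule refl)
  also have "measure_pmf.expectation p (\<lambda>x. 1 - s\<^sup>2 * (X x)\<^sup>2 / 2 + s\<^sup>2 * g x)
      = 1 - s\<^sup>2 * measure_pmf.expectation p (\<lambda>x. (X x)\<^sup>2) / 2 + s\<^sup>2 * measure_pmf.expectation p g"
    by (simp add: int)
  finally have ET: "measure_pmf.expectation p T = of_real (1 - s\<^sup>2 * measure_pmf.expectation p (\<lambda>x. (X x)\<^sup>2) / 2
              + s\<^sup>2 * measure_pmf.expectation p g)"
    by (simp add: mean_X)
  have "cmod (iexp (s * X x) * (1 + s\<^sup>2 * g x) - T x) \<le> (K ^ 3 / 6 + K * L) * \<bar>s\<bar> ^ 3"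
    if x: "x \<in> set_pmf p" for x
  proof -
    let ?a = "s * X x"
    have "0 \<le> K" using X[OF x] by linarith
    have a: "\<bar>?a\<bar> \<le> \<bar>s\<bar> * K" using X[OF x] by (simp add: abs_mult mult_left_mono)
    have "iexp ?a * (1 + s\<^sup>2 * g x) - T x
        = (iexp ?a - (1 + \<i> * ?a - ?a\<^sup>2 / 2)) + (iexp ?a - 1) * (s\<^sup>2 * g x)"
      unfolding T_def by (simp add: algebra_simps power2_eq_square)
    also have "cmod \<dots> \<le> \<bar>?a\<bar> ^ 3 / 6 + \<bar>?a\<bar> * (s\<^sup>2 * \<bar>g x\<bar>)"
    proof (rule order_trans[OF norm_triangle_ineq], rule add_mono)
      show "cmod (iexp ?a - (1 + \<i> * ?a - ?a\<^sup>2 / 2)) \<le> \<bar>?a\<bar> ^ 3 / 6"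
        by (rule iexp_second_order)
      have "cmod ((iexp ?a - 1) * (s\<^sup>2 * g x)) = cmod (iexp ?a - 1) * (s\<^sup>2 * \<bar>g x\<bar>)"
        unfolding norm_mult norm_of_real abs_mult abs_power2 ..
      then show "cmod ((iexp ?a - 1) * (s\<^sup>2 * g x)) \<le> \<bar>?a\<bar> * (s\<^sup>2 * \<bar>g x\<bar>)"
        using mult_right_mono[OF norm_iexp_minus_one[of ?a], of "s\<^sup>2 * \<bar>g x\<bar>"] by simp
    qed
    also have "\<dots> \<le> (\<bar>s\<bar> * K) ^ 3 / 6 + (\<bar>s\<bar> * K) * (s\<^sup>2 * L)"
    proof -
      have "\<bar>?a\<bar> ^ 3 \<le> (\<bar>s\<bar> * K) ^ 3" using a by (rule power_mono) simp
      moreover have "\<bar>?a\<bar> * (s\<^sup>2 * \<bar>g x\<bar>) \<le> (\<bar>s\<bar> * K) * (s\<^sup>2 * L)"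
        by (rule mult_mono[OF a mult_left_mono[OF g[OF x]]]) (use \<open>0 \<le> K\<close> in auto)
      ultimately show ?thesis by linarith
    qed
    also have "\<dots> = (K ^ 3 / 6 + K * L) * \<bar>s\<bar> ^ 3"
    proof -
      have "(q * K) ^ 3 / 6 + (q * K) * (q\<^sup>2 * L) = (K ^ 3 / 6 + K * L) * q ^ 3" for q :: real
        by (simp add: power3_eq_cube power2_eq_square algebra_simps)
      from this[of "\<bar>s\<bar>"] show ?thesis by simp
    qed
    finally show ?thesis .
  qed
  then have "cmod (measure_pmf.expectation p (\<lambda>x. iexp (s * X x) * (1 + s\<^sup>2 * g x) - T x))
      \<le> (K ^ 3 / 6 + K * L) * \<bar>s\<bar> ^ 3"
    by (rule norm_expectation_le[OF fin])
  then show ?thesis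
    by (simp only: Bochner_Integration.integral_diff int ET)
qed

section \<open>The path law and its twisted transition operator\<close>

context mh
begin

lemma set_mh_step: "x \<in> E \<Longrightarrow> set_pmf (mh_step Q \<rho> x) \<subseteq> E \<times> E"
  unfolding mh_step_def set_bind_pmf set_return_pmf using set_Q[of x] by auto

lemma finite_mh_step: "x \<in> E \<Longrightarrow> finite (set_pmf (mh_step Q \<rho> x))"
  by (rule finite_subset[OF set_mh_step]) simp_all

lemma expectation_mh_step:
  fixes \<Phi> :: "'a \<times> 'a \<Rightarrow> real"
  assumes "x \<in> E"
  shows "measure_pmf.expectation (mh_step Q \<rho> x) \<Phi>
    = (\<Sum>y\<in>E. pmf (Q x) y * (\<rho> x y * \<Phi> (y, y) + (1 - \<rho> x y) * \<Phi> (y, x)))"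
proof -
  have "measure_pmf.expectation (mh_step Q \<rho> x) \<Phi>
      = (\<Sum>y\<in>E. pmf (Q x) y * measure_pmf.expectation
          (map_pmf (\<lambda>accept. (y, if accept then y else x)) (bernoulli_pmf (\<rho> x y))) \<Phi>)"
    unfolding mh_step_def map_pmf_def using assms set_Q
    by (subst pmf_expectation_bind[of E]) auto
  also have "\<dots> = (\<Sum>y\<in>E. pmf (Q x) y * (\<rho> x y * \<Phi> (y, y) + (1 - \<rho> x y) * \<Phi> (y, x)))"
  proof (intro sum.cong refl)
    fix y assume "y \<in> E"
    then show "pmf (Q x) y * measure_pmf.expectation
          (map_pmf (\<lambda>accept. (y, if accept then y else x)) (bernoulli_pmf (\<rho> x y))) \<Phi>
        = pmf (Q x) y * (\<rho> x y * \<Phi> (y, y) + (1 - \<rho> x y) * \<Phi> (y, x))"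
      \<comment> \<open>The value \<rho> x y is only known to be a probability when y can be
        proposed from x; otherwise the weight \<open>pmf (Q x) y\<close> is 0 and both sides
        vanish.\<close>
      using rho_bounds[OF assms, of y] by (cases "pmf (Q x) y = 0") (auto simp: mult.commute)
  qed
  finally show ?thesis .
qed

lemma expectation_mh_step_snd:
  "x \<in> E \<Longrightarrow> measure_pmf.expectation (mh_step Q \<rho> x) (\<lambda>yz. h (snd yz)) = P h x"
  by (simp add: expectation_mh_step mh_op_eq)

definition path_sum :: "('a \<Rightarrow> 'a \<times> 'a \<Rightarrow> real) \<Rightarrow> nat \<Rightarrow> (nat \<Rightarrow> 'a) \<times> (nat \<Rightarrow> 'a) \<Rightarrow> real" where
  "path_sum U n \<omega> = (\<Sum>k<n. U (fst \<omega> k) (snd \<omega> (Suc k), fst \<omega> (Suc k)))"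

text \<open>The Fourier perturbation of the transition operator in Nagaev's method; s = 0 gives back
  the transition operator itself.\<close>

definition twisted :: "('a \<Rightarrow> 'a \<times> 'a \<Rightarrow> real) \<Rightarrow> real \<Rightarrow> ('a \<Rightarrow> complex) \<Rightarrow> 'a \<Rightarrow> complex" where
  "twisted U s h x = measure_pmf.expectation (mh_step Q \<rho> x) (\<lambda>yz. iexp (s * U x yz) * h (snd yz))"

text \<open>The test function h at the endpoint is what lets the recursion in n close; the
  characteristic function of the path sum is the case h = 1.\<close>

definition path_expectation ::
    "'a pmf \<Rightarrow> ('a \<Rightarrow> 'a \<times> 'a \<Rightarrow> real) \<Rightarrow> real \<Rightarrow> nat \<Rightarrow> ('a \<Rightarrow> complex) \<Rightarrow> complex" where
  "path_expectation \<nu> U s n h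
     = measure_pmf.expectation (mh_chain \<nu> Q \<rho> n) (\<lambda>\<omega>. iexp (s * path_sum U n \<omega>) * h (fst \<omega> n))"

lemma mh_chain_Suc:
  "mh_chain \<nu> Q \<rho> (Suc n) = bind_pmf (mh_chain \<nu> Q \<rho> n) (\<lambda>\<omega>.
     map_pmf (\<lambda>yz. ((fst \<omega>)(Suc n := snd yz), (snd \<omega>)(Suc n := fst yz))) (mh_step Q \<rho> (fst \<omega> n)))"
  by (simp only: mh_chain.simps map_pmf_def case_prod_unfold)

text \<open>Finite support makes every integrability condition automatic, and endpoints in
  \<open>E\<close> allow the one-step estimates to be applied.\<close>

lemma mh_chain_support:
  assumes "set_pmf \<nu> \<subseteq> E"
  shows "finite (set_pmf (mh_chain \<nu> Q \<rho> n)) \<and> (\<forall>\<omega>\<in>set_pmf (mh_chain \<nu> Q \<rho> n). fst \<omega> n \<in> E)"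
proof (induction n)
  case 0
  then show ?case using assms finite_subset[OF assms] by auto
next
  case (Suc n)
  have set: "set_pmf (mh_chain \<nu> Q \<rho> (Suc n)) = (\<Union>\<omega>\<in>set_pmf (mh_chain \<nu> Q \<rho> n).
      (\<lambda>yz. ((fst \<omega>)(Suc n := snd yz), (snd \<omega>)(Suc n := fst yz))) ` set_pmf (mh_step Q \<rho> (fst \<omega> n)))"
    unfolding mh_chain_Suc by (simp only: set_bind_pmf set_map_pmf)
  show ?case
  proof
    show "finite (set_pmf (mh_chain \<nu> Q \<rho> (Suc n)))"
      unfolding set using Suc finite_mh_step by blast
    show "\<forall>\<omega>\<in>set_pmf (mh_chain \<nu> Q \<rho> (Suc n)). fst \<omega> (Suc n) \<in> E"
    proof
      fix \<omega>' assume "\<omega>' \<in> set_pmf (mh_chain \<nu> Q \<rho> (Suc n))"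
      then obtain \<omega> yz where "\<omega> \<in> set_pmf (mh_chain \<nu> Q \<rho> n)" "yz \<in> set_pmf (mh_step Q \<rho> (fst \<omega> n))"
        and "fst \<omega>' (Suc n) = snd yz"
        unfolding set by auto
      then show "fst \<omega>' (Suc n) \<in> E"
        using Suc set_mh_step by fastforce
    qed
  qed
qed

text \<open>The Markov property: conditionally on the path up to time n, the last exponential factor
  and the endpoint function integrate to the twisted operator at the current state.\<close>

lemma path_expectation_Suc:
  assumes "set_pmf \<nu> \<subseteq> E"
  shows "path_expectation \<nu> U s (Suc n) h = path_expectation \<nu> U s n (twisted U s h)"
proof -
  note supp = mh_chain_support[OF assms, of n]
  let ?next = "\<lambda>\<omega> yz. ((fst \<omega>)(Suc n := snd yz), (snd \<omega>)(Suc n := fst yz))"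
  have sum: "path_sum U (Suc n) (?next \<omega> yz) = path_sum U n \<omega> + U (fst \<omega> n) yz" for \<omega> yz
  proof -
    \<comment> \<open>The first n increments read only coordinates up to n, so overwriting
      coordinate \<open>Suc n\<close> leaves them unchanged.\<close>
    have "path_sum U n (?next \<omega> yz) = path_sum U n \<omega>"
      unfolding path_sum_def by (rule sum.cong) auto
    then show ?thesis by (simp add: path_sum_def)
  qed
  have iexp_mult: "iexp (s * (a + b)) * c = iexp (s * a) * (iexp (s * b) * c)" for a b c
    unfolding distrib_left of_real_add exp_add mult.assoc ..
  have "path_expectation \<nu> U s (Suc n) h
      = measure_pmf.expectation (mh_chain \<nu> Q \<rho> n) (\<lambda>\<omega>.
          measure_pmf.expectation (map_pmf (?next \<omega>) (mh_step Q \<rho> (fst \<omega> n)))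
            (\<lambda>\<omega>. iexp (s * path_sum U (Suc n) \<omega>) * h (fst \<omega> (Suc n))))"
    unfolding path_expectation_def mh_chain_Suc
  proof (rule expectation_bind_finite)
    show "finite (set_pmf (mh_chain \<nu> Q \<rho> n))" using supp by blast
    show "finite (set_pmf (map_pmf (?next \<omega>) (mh_step Q \<rho> (fst \<omega> n))))"
      if "\<omega> \<in> set_pmf (mh_chain \<nu> Q \<rho> n)" for \<omega>
      unfolding set_map_pmf using supp finite_mh_step that by blast
  qed
  also have "\<dots> = path_expectation \<nu> U s n (twisted U s h)"
    unfolding path_expectation_def twisted_def integral_map_pmf sum iexp_mult fst_conv fun_upd_same
      integral_mult_right_zero ..
  finally show ?thesis .
qed

lemma norm_path_expectation_le:
  assumes "set_pmf \<nu> \<subseteq> E" "\<And>x. x \<in> E \<Longrightarrow> cmod (h x) \<le> B"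
  shows "cmod (path_expectation \<nu> U s n h) \<le> B"
  unfolding path_expectation_def
proof (rule norm_expectation_le)
  note supp = mh_chain_support[OF assms(1), of n]
  show "finite (set_pmf (mh_chain \<nu> Q \<rho> n))" using supp by blast
  show "cmod (iexp (s * path_sum U n \<omega>) * h (fst \<omega> n)) \<le> B"
    if "\<omega> \<in> set_pmf (mh_chain \<nu> Q \<rho> n)" for \<omega>
    unfolding norm_mult norm_exp_i_times mult_1_left using supp assms(2) that by blast
qed

lemma path_expectation_diff:
  assumes "set_pmf \<nu> \<subseteq> E"
  shows "path_expectation \<nu> U s n (\<lambda>x. g x - h x)
    = path_expectation \<nu> U s n g - path_expectation \<nu> U s n h"
proof -
  have fin: "finite (set_pmf (mh_chain \<nu> Q \<rho> n))" using mh_chain_support[OF assms] by blast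
  show ?thesis
    unfolding path_expectation_def right_diff_distrib
    by (intro Bochner_Integration.integral_diff integrable_measure_pmf_finite fin)
qed

lemma path_expectation_cmult:
  "path_expectation \<nu> U s n (\<lambda>x. c * h x) = c * path_expectation \<nu> U s n h"
  unfolding path_expectation_def mult.left_commute[of _ c] integral_mult_right_zero ..

text \<open>Telescoping: each step exchanges the twisted operator for the factor r at cost
  \<epsilon>. Errors add up without amplification because |r| is at most 1 and path expectations are
  bounded by the sup norm.\<close>

lemma approximate_eigenfunction:
  assumes \<nu>: "set_pmf \<nu> \<subseteq> E" and r: "cmod r \<le> 1"
    and eig: "\<And>x. x \<in> E \<Longrightarrow> cmod (twisted U s h x - r * h x) \<le> \<epsilon>"
  shows "cmod (path_expectation \<nu> U s n h - r ^ n * path_expectation \<nu> U s 0 h) \<le> n * \<epsilon>"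
proof (induction n)
  case (Suc n)
  let ?\<Phi> = "path_expectation \<nu> U s"
  have alg: "a - r ^ Suc n * c = (a - r * b) + r * (b - r ^ n * c)" for a b c
    by (simp add: right_diff_distrib)
  have "?\<Phi> (Suc n) h - r ^ Suc n * ?\<Phi> 0 h
      = ?\<Phi> n (\<lambda>x. twisted U s h x - r * h x) + r * (?\<Phi> n h - r ^ n * ?\<Phi> 0 h)"
    unfolding path_expectation_Suc[OF \<nu>] path_expectation_diff[OF \<nu>] path_expectation_cmult
    by (rule alg)
  also have "cmod \<dots> \<le> \<epsilon> + 1 * (n * \<epsilon>)"
  proof (rule norm_triangle_le, rule add_mono)
    show "cmod (?\<Phi> n (\<lambda>x. twisted U s h x - r * h x)) \<le> \<epsilon>"
      by (rule norm_path_expectation_le[OF \<nu> eig])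
    show "cmod (r * (?\<Phi> n h - r ^ n * ?\<Phi> 0 h)) \<le> 1 * (n * \<epsilon>)"
      unfolding norm_mult by (rule mult_mono[OF r Suc]) simp_all
  qed
  finally show ?case by (simp add: distrib_right)
qed simp

section \<open>Martingale increments and their variance\<close>

text \<open>Pairs with X_1 = X_0 contribute nothing to E_\<pi>[(1 - \<rho>(X_0,X_1)) (g(X_1) -
  g(X_0))^2], so the joint law of (X_0, X_1) may be replaced by the flux.\<close>

definition rejection_form :: "('a \<Rightarrow> real) \<Rightarrow> real" where
  "rejection_form g = (\<Sum>x\<in>E. \<Sum>y\<in>E. flux x y * (1 - \<rho> x y) * (g y - g x)\<^sup>2)"

text \<open>The usual increment attached to the Poisson equation plus the control variate
  E[\<psi>(X_1) | X_0, proposal] - \<psi>(X_1). Both parts are centred given X_0.\<close>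

definition martingale_increment :: "('a \<Rightarrow> real) \<Rightarrow> ('a \<Rightarrow> real) \<Rightarrow> 'a \<Rightarrow> 'a \<times> 'a \<Rightarrow> real" where
  "martingale_increment F \<psi> x yz = F (snd yz) - P F x
     + (\<rho> x (fst yz) * \<psi> (fst yz) + (1 - \<rho> x (fst yz)) * \<psi> x - \<psi> (snd yz))"

lemma expectation_martingale_increment:
  assumes "x \<in> E"
  shows "measure_pmf.expectation (mh_step Q \<rho> x) (martingale_increment F \<psi> x) = 0"
proof -
  have "measure_pmf.expectation (mh_step Q \<rho> x) (martingale_increment F \<psi> x)
      = (\<Sum>y\<in>E. pmf (Q x) y * (\<rho> x y * F y + (1 - \<rho> x y) * F x) - pmf (Q x) y * P F x)"
    unfolding expectation_mh_step[OF assms]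
    by (intro sum.cong refl) (simp add: martingale_increment_def algebra_simps)
  also have "\<dots> = P F x - 1 * P F x"
    unfolding sum_subtractf sum_distrib_right[symmetric] sum_Q[OF assms] mh_op_eq[OF assms, of F] ..
  finally show ?thesis by simp
qed

text \<open>Condition on the proposal y. The conditional mean does not involve \<psi>, and the
  conditional variance is that of a two-valued variable, \<rho> (1 - \<rho>) times the squared
  increment of \<psi> - F between x and y. Comparing with \<psi> = 0, where the second moment is
  P(F^2) - (P F)^2, gives the formula.\<close>

lemma expectation_martingale_increment_square:
  assumes "x \<in> E"
  shows "measure_pmf.expectation (mh_step Q \<rho> x) (\<lambda>yz. (martingale_increment F \<psi> x yz)\<^sup>2)
    = P (\<lambda>y. (F y)\<^sup>2) x - (P F x)\<^sup>2
      + (\<Sum>y\<in>E. pmf (Q x) y * \<rho> x y * (1 - \<rho> x y) * (((\<psi> y - F y) - (\<psi> x - F x))\<^sup>2 - (F y - F x)\<^sup>2))"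
    (is "_ = _ + ?R")
proof -
  define m where "m = P F x"
  have "measure_pmf.expectation (mh_step Q \<rho> x) (\<lambda>yz. (martingale_increment F \<psi> x yz)\<^sup>2)
      = (\<Sum>y\<in>E. pmf (Q x) y * (\<rho> x y * (F y)\<^sup>2 + (1 - \<rho> x y) * (F x)\<^sup>2)
          - pmf (Q x) y * (\<rho> x y * F y + (1 - \<rho> x y) * F x) * (2 * m) + pmf (Q x) y * m\<^sup>2
          + pmf (Q x) y * \<rho> x y * (1 - \<rho> x y) * (((\<psi> y - F y) - (\<psi> x - F x))\<^sup>2 - (F y - F x)\<^sup>2))"
    unfolding expectation_mh_step[OF assms]
    by (intro sum.cong refl)
       (simp add: martingale_increment_def m_def[symmetric] power2_eq_square algebra_simps)
  also have "\<dots> = P (\<lambda>y. (F y)\<^sup>2) x - m * (2 * m) + 1 * m\<^sup>2 + ?R"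
    unfolding sum.distrib sum_subtractf sum_distrib_right[symmetric] sum_Q[OF assms]
      mh_op_eq[OF assms, of "\<lambda>y. (F y)\<^sup>2"] m_def mh_op_eq[OF assms, of F] ..
  finally show ?thesis by (simp add: m_def power2_eq_square)
qed

definition wr_variance :: "('a \<Rightarrow> real) \<Rightarrow> ('a \<Rightarrow> real) \<Rightarrow> real" where
  "wr_variance F \<psi> = avg (\<lambda>x. measure_pmf.expectation (mh_step Q \<rho> x)
     (\<lambda>yz. (martingale_increment F \<psi> x yz)\<^sup>2))"

lemma wr_variance_eq:
  "wr_variance F \<psi> = avg (\<lambda>x. (F x)\<^sup>2) - avg (\<lambda>x. (P F x)\<^sup>2)
     - rejection_form F + rejection_form (\<lambda>x. \<psi> x - F x)"
proof -
  have "wr_variance F \<psi> = avg (\<lambda>x. P (\<lambda>y. (F y)\<^sup>2) x - (P F x)\<^sup>2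
      + (\<Sum>y\<in>E. pmf (Q x) y * \<rho> x y * (1 - \<rho> x y) * (((\<psi> y - F y) - (\<psi> x - F x))\<^sup>2 - (F y - F x)\<^sup>2)))"
    unfolding wr_variance_def by (rule mean_cong) (rule expectation_martingale_increment_square)
  also have "\<dots> = avg (\<lambda>x. (F x)\<^sup>2) - avg (\<lambda>x. (P F x)\<^sup>2)
      + avg (\<lambda>x. \<Sum>y\<in>E. pmf (Q x) y * \<rho> x y * (1 - \<rho> x y) * (((\<psi> y - F y) - (\<psi> x - F x))\<^sup>2 - (F y - F x)\<^sup>2))"
    unfolding mean_add mean_diff mean_mh_op ..
  also have "avg (\<lambda>x. \<Sum>y\<in>E. pmf (Q x) y * \<rho> x y * (1 - \<rho> x y) * (((\<psi> y - F y) - (\<psi> x - F x))\<^sup>2 - (F y - F x)\<^sup>2))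
      = rejection_form (\<lambda>x. \<psi> x - F x) - rejection_form F"
    unfolding mean_def rejection_form_def flux_def sum_subtractf[symmetric] sum_distrib_left
    by (intro sum.cong refl) (simp add: algebra_simps)
  finally show ?thesis by simp
qed

lemma wr_variance_nonneg: "0 \<le> wr_variance F \<psi>"
  unfolding wr_variance_def mean_def by (intro sum_nonneg mult_nonneg_nonneg integral_nonneg_AE) auto

lemma finite_abs_bound:
  obtains B :: real where "0 \<le> B" "\<And>x. x \<in> E \<Longrightarrow> \<bar>h x\<bar> \<le> B"
proof
  show "0 \<le> (\<Sum>x\<in>E. \<bar>h x\<bar>)" by (rule sum_nonneg) simp
  show "\<bar>h x\<bar> \<le> (\<Sum>x\<in>E. \<bar>h x\<bar>)" if "x \<in> E" for x
    using that by (intro member_le_sum) simp_all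
qed

lemma martingale_increment_bound:
  obtains K where "\<And>x yz. x \<in> E \<Longrightarrow> yz \<in> E \<times> E \<Longrightarrow> \<bar>martingale_increment F \<psi> x yz\<bar> \<le> K"
proof
  fix x yz assume *: "x \<in> E" "yz \<in> E \<times> E"
  let ?S = "\<lambda>x. \<Sum>yz\<in>E \<times> E. \<bar>martingale_increment F \<psi> x yz\<bar>"
  have "\<bar>martingale_increment F \<psi> x yz\<bar> \<le> ?S x"
    using *(2) by (intro member_le_sum) simp_all
  also have "\<dots> \<le> (\<Sum>x\<in>E. ?S x)"
    using *(1) by (intro member_le_sum[of x E ?S]) (simp_all add: sum_nonneg)
  finally show "\<bar>martingale_increment F \<psi> x yz\<bar> \<le> (\<Sum>x\<in>E. ?S x)" .
qed

text \<open>With \<open>G\<close> the corrector solving \<open>G - P G = (v - w) / 2\<close>, where \<open>w\<close> is the conditional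
  variance of the increment and \<open>v\<close> its stationary mean, the function \<open>1 + s\<^sup>2 G\<close> is an
  eigenfunction of the twisted operator up to an error of order \<open>s\<^sup>3\<close>; this replaces spectral
  perturbation theory.\<close>

lemma twisted_corrector:
  fixes F \<psi> :: "'a \<Rightarrow> real"
  defines "v \<equiv> wr_variance F \<psi>"
  obtains G C where "0 \<le> C"
    "\<And>s x. x \<in> E \<Longrightarrow> cmod (twisted (martingale_increment F \<psi>) s (\<lambda>z. 1 + s\<^sup>2 * G z) x
       - complex_of_real (1 - s\<^sup>2 * v / 2) * (1 + s\<^sup>2 * G x)) \<le> C * (\<bar>s\<bar> ^ 3 + s ^ 4)"
proof -
  define w where "w x = measure_pmf.expectation (mh_step Q \<rho> x)
     (\<lambda>yz. (martingale_increment F \<psi> x yz)\<^sup>2)" for x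
  have "avg (\<lambda>x. v / 2 - (1 / 2) * w x) = 0"
    unfolding mean_diff mean_const mean_cmult by (simp add: v_def wr_variance_def w_def[abs_def])
  from poisson_solvable[OF this] obtain G where
    G: "\<And>x. x \<in> E \<Longrightarrow> G x - P G x = v / 2 - (1 / 2) * w x" by blast
  obtain L where L: "0 \<le> L" "\<And>x. x \<in> E \<Longrightarrow> \<bar>G x\<bar> \<le> L"
    using finite_abs_bound[of G] by blast
  obtain K where K: "\<And>x yz. x \<in> E \<Longrightarrow> yz \<in> E \<times> E \<Longrightarrow> \<bar>martingale_increment F \<psi> x yz\<bar> \<le> K"
    using martingale_increment_bound[of F \<psi>] by blast
  obtain x0 where "x0 \<in> E" using E_nonempty by blast
  then have "0 \<le> K" using K[of x0 "(x0, x0)"] by force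
  have "0 \<le> v" unfolding v_def by (rule wr_variance_nonneg)
  define C where "C = (K ^ 3 / 6 + K * L) + v / 2 * L"
  show ?thesis
  proof (rule that)
    show "0 \<le> C"
      using \<open>0 \<le> K\<close> \<open>0 \<le> L\<close> \<open>0 \<le> v\<close> by (simp add: C_def)
  next
    fix s x assume x: "x \<in> E"
    let ?T = "twisted (martingale_increment F \<psi>) s (\<lambda>z. 1 + s\<^sup>2 * G z) x"
    let ?c = "1 - s\<^sup>2 * w x / 2 + s\<^sup>2 * P G x"
    have supp: "\<And>yz. yz \<in> set_pmf (mh_step Q \<rho> x) \<Longrightarrow> yz \<in> E \<times> E"
      using set_mh_step[OF x] by blast
    have 1: "cmod (?T - complex_of_real ?c) \<le> (K ^ 3 / 6 + K * L) * \<bar>s\<bar> ^ 3"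
      unfolding twisted_def w_def expectation_mh_step_snd[OF x, symmetric]
    proof (rule twisted_expectation_approx[OF finite_mh_step[OF x] expectation_martingale_increment[OF x]])
      fix yz assume "yz \<in> set_pmf (mh_step Q \<rho> x)"
      note yz = supp[OF this]
      show "\<bar>martingale_increment F \<psi> x yz\<bar> \<le> K" using K[OF x yz] .
      show "\<bar>G (snd yz)\<bar> \<le> L" using yz by (intro L(2)) auto
    qed
    \<comment> \<open>The coefficient of s^2 cancels exactly by the equation for the corrector; only
      the product term of order s^4 survives.\<close>
    have "?c - (1 - s\<^sup>2 * v / 2) * (1 + s\<^sup>2 * G x)
        = s\<^sup>2 * (v / 2 - (1 / 2) * w x - (G x - P G x)) + v / 2 * G x * s ^ 4"
      by (simp add: power4_eq_xxxx power2_eq_square algebra_simps)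
    also have "\<dots> = v / 2 * G x * s ^ 4" unfolding G[OF x] by simp
    finally have "complex_of_real (?c - (1 - s\<^sup>2 * v / 2) * (1 + s\<^sup>2 * G x)) = of_real (v / 2 * G x * s ^ 4)"
      by (rule arg_cong)
    then have 2: "complex_of_real ?c - complex_of_real (1 - s\<^sup>2 * v / 2) * (1 + s\<^sup>2 * G x) = complex_of_real (v / 2 * G x * s ^ 4)"
      by (simp only: of_real_1 of_real_add of_real_diff of_real_mult of_real_power)
    have 3: "cmod (complex_of_real (v / 2 * G x * s ^ 4)) \<le> v / 2 * L * s ^ 4"
      unfolding norm_of_real abs_mult using \<open>0 \<le> v\<close> L(2)[OF x]
      by (intro mult_mono mult_nonneg_nonneg) auto
    have "?T - complex_of_real (1 - s\<^sup>2 * v / 2) * (1 + s\<^sup>2 * G x)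
        = (?T - complex_of_real ?c) + complex_of_real (v / 2 * G x * s ^ 4)"
      unfolding 2[symmetric] by (simp only: diff_add_cancel add_diff_eq)
    also have "cmod \<dots> \<le> (K ^ 3 / 6 + K * L) * \<bar>s\<bar> ^ 3 + v / 2 * L * s ^ 4"
      by (rule order_trans[OF norm_triangle_ineq add_mono[OF 1 3]])
    also have "\<dots> \<le> C * \<bar>s\<bar> ^ 3 + C * s ^ 4"
      using \<open>0 \<le> K\<close> \<open>0 \<le> L\<close> \<open>0 \<le> v\<close>
      by (intro add_mono mult_right_mono) (simp_all add: C_def)
    finally show "cmod (?T - complex_of_real (1 - s\<^sup>2 * v / 2) * (1 + s\<^sup>2 * G x)) \<le> C * (\<bar>s\<bar> ^ 3 + s ^ 4)"
      by (simp add: distrib_left)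
  qed
qed

end

section \<open>From martingale increments to the limit law of the estimator\<close>

lemma char_scaled_std_normal:
  assumes "0 \<le> v"
  shows "char (distr std_normal_distribution borel (\<lambda>z. sqrt v * z)) t = complex_of_real (exp (- (t\<^sup>2 * v / 2)))"
proof -
  have "char (distr std_normal_distribution borel (\<lambda>z. sqrt v * z)) t = char std_normal_distribution (t * sqrt v)"
    unfolding char_def by (subst integral_distr) (simp_all add: mult.assoc)
  also have "\<dots> = complex_of_real (exp (- (t\<^sup>2 * v / 2)))"
    using assms by (simp add: char_std_normal_distribution power_mult_distrib)
  finally show ?thesis .
qed

lemma real_distribution_scaled_std_normal:
  "real_distribution (distr std_normal_distribution borel (\<lambda>z. sqrt v * z))"
proof -
  interpret real_distribution std_normal_distribution by (rule real_dist_normal_dist)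
  show ?thesis by (rule real_distribution_distr) simp
qed

context mh
begin

text \<open>The function f is read at the next state because the ergodic average runs over X_1, ...,
  X_n; both averages then become one sum over transitions.\<close>

definition wr_increment :: "('a \<Rightarrow> real) \<Rightarrow> ('a \<Rightarrow> real) \<Rightarrow> 'a \<Rightarrow> 'a \<times> 'a \<Rightarrow> real" where
  "wr_increment f \<psi> x yz = f (snd yz) - avg f
     + (\<rho> x (fst yz) * \<psi> (fst yz) + (1 - \<rho> x (fst yz)) * \<psi> x - \<psi> (snd yz))"

lemma path_sum_wr_increment:
  assumes "n > 0"
  shows "sqrt n * (wr_estimator \<rho> f \<psi> n \<omega> - avg f) = path_sum (wr_increment f \<psi>) n \<omega> / sqrt n"
proof -
  have "path_sum (wr_increment f \<psi>) n \<omega> = n * (wr_estimator \<rho> f \<psi> n \<omega> - avg f)"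
    using assms
    by (simp add: path_sum_def wr_increment_def wr_estimator_def split_beta sum.distrib sum_subtractf
        sum.atLeast1_atMost_eq field_simps)
  then have "path_sum (wr_increment f \<psi>) n \<omega> / sqrt n = n / sqrt n * (wr_estimator \<rho> f \<psi> n \<omega> - avg f)"
    by simp
  then show ?thesis
    by (simp only: real_div_sqrt of_nat_0_le_iff)
qed

lemma char_wr_estimator:
  assumes "n > 0"
  shows "char (distr (measure_pmf (mh_chain \<nu> Q \<rho> n)) borel
            (\<lambda>\<omega>. sqrt n * (wr_estimator \<rho> f \<psi> n \<omega> - avg f))) t
    = path_expectation \<nu> (wr_increment f \<psi>) (t / sqrt n) n (\<lambda>_. 1)"
  unfolding char_def path_expectation_def
  by (subst integral_distr) (simp_all add: path_sum_wr_increment[OF assms])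

text \<open>The coboundary \<open>P F x - P F z\<close> by which the increments of the estimator differ from martingale
  increments only conjugates the twisted operator by \<open>iexp (s * P F x)\<close>.\<close>

lemma twisted_wr_increment:
  assumes F: "\<And>x. x \<in> E \<Longrightarrow> F x - P F x = f x - avg f" and x: "x \<in> E"
  shows "twisted (wr_increment f \<psi>) s (\<lambda>z. iexp (s * P F z) * g z) x
    = iexp (s * P F x) * twisted (martingale_increment F \<psi>) s g x"
  unfolding twisted_def integral_mult_right_zero[symmetric]
proof (rule integral_cong_AE)
  have iexp: "iexp (s * (d + a - b)) * (iexp (s * b) * c) = iexp (s * a) * (iexp (s * d) * c)" for a b c d
    unfolding mult.assoc[symmetric] exp_add[symmetric] by (simp add: algebra_simps)
  have "iexp (s * wr_increment f \<psi> x yz) * (iexp (s * P F (snd yz)) * g (snd yz))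
      = iexp (s * P F x) * (iexp (s * martingale_increment F \<psi> x yz) * g (snd yz))"
    if "yz \<in> set_pmf (mh_step Q \<rho> x)" for yz
  proof -
    have "snd yz \<in> E" using set_mh_step[OF x] that by auto
    from F[OF this] have "wr_increment f \<psi> x yz = martingale_increment F \<psi> x yz + P F x - P F (snd yz)"
      by (simp add: wr_increment_def martingale_increment_def)
    then show ?thesis by (simp only: iexp)
  qed
  then show "AE yz in measure_pmf (mh_step Q \<rho> x).
      iexp (s * wr_increment f \<psi> x yz) * (iexp (s * P F (snd yz)) * g (snd yz))
      = iexp (s * P F x) * (iexp (s * martingale_increment F \<psi> x yz) * g (snd yz))"
    by (simp only: AE_measure_pmf_iff) blast
qed simp_all

text \<open>The corrected function, conjugated by the coboundary, is an approximate eigenfunction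
  with eigenvalue 1 - s^2 v / 2. Replacing it by 1 at both ends of the path costs O(|s| + s^2). The
  constant is uniform in the initial law, s and n, so s may later depend on n.\<close>

lemma path_expectation_approx:
  fixes F f \<psi> :: "'a \<Rightarrow> real"
  assumes F: "\<And>x. x \<in> E \<Longrightarrow> F x - P F x = f x - avg f"
  defines "v \<equiv> wr_variance F \<psi>"
  obtains C where "\<And>\<nu> s n. set_pmf \<nu> \<subseteq> E \<Longrightarrow> s\<^sup>2 * v / 2 \<le> 1 \<Longrightarrow>
    cmod (path_expectation \<nu> (wr_increment f \<psi>) s n (\<lambda>_. 1) - complex_of_real ((1 - s\<^sup>2 * v / 2) ^ n))
      \<le> C * (n * (\<bar>s\<bar> ^ 3 + s ^ 4) + (\<bar>s\<bar> + s\<^sup>2))"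
proof -
  obtain G C where "0 \<le> C" and GC: "\<And>s x. x \<in> E \<Longrightarrow>
      cmod (twisted (martingale_increment F \<psi>) s (\<lambda>z. 1 + s\<^sup>2 * G z) x
       - complex_of_real (1 - s\<^sup>2 * v / 2) * (1 + s\<^sup>2 * G x)) \<le> C * (\<bar>s\<bar> ^ 3 + s ^ 4)"
    by (rule twisted_corrector[of F \<psi>, folded v_def]) (rule that)
  obtain M where M: "0 \<le> M" "\<And>x. x \<in> E \<Longrightarrow> \<bar>P F x\<bar> \<le> M"
    using finite_abs_bound[of "P F"] by blast
  obtain L where L: "0 \<le> L" "\<And>x. x \<in> E \<Longrightarrow> \<bar>G x\<bar> \<le> L"
    using finite_abs_bound[of G] by blast
  show ?thesis
  proof (rule that)
    fix \<nu> :: "'a pmf" and s :: real and n :: nat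
    assume \<nu>: "set_pmf \<nu> \<subseteq> E" and s: "s\<^sup>2 * v / 2 \<le> 1"
    define r where "r = 1 - s\<^sup>2 * v / 2"
    define h where "h x = iexp (s * P F x) * (1 + s\<^sup>2 * G x)" for x
    define B where "B = \<bar>s\<bar> * M + s\<^sup>2 * L"
    let ?\<Phi> = "path_expectation \<nu> (wr_increment f \<psi>) s"
    \<comment> \<open>With the smallness condition on s this puts r in [0,1], so its powers do not
      amplify errors.\<close>
    have "0 \<le> s\<^sup>2 * v" using wr_variance_nonneg by (simp add: v_def)
    then have r: "cmod (complex_of_real r) \<le> 1"
      unfolding norm_of_real using s by (simp add: r_def abs_le_iff)
    have 1: "cmod (?\<Phi> n h - complex_of_real r ^ n * ?\<Phi> 0 h) \<le> n * (C * (\<bar>s\<bar> ^ 3 + s ^ 4))"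
    proof (rule approximate_eigenfunction[OF \<nu> r])
      fix x assume x: "x \<in> E"
      have tw: "twisted (wr_increment f \<psi>) s h x
          = iexp (s * P F x) * twisted (martingale_increment F \<psi>) s (\<lambda>z. 1 + s\<^sup>2 * G z) x"
        unfolding h_def by (rule twisted_wr_increment[OF F x])
      have "twisted (wr_increment f \<psi>) s h x - complex_of_real r * h x = iexp (s * P F x) *
          (twisted (martingale_increment F \<psi>) s (\<lambda>z. 1 + s\<^sup>2 * G z) x - complex_of_real r * (1 + s\<^sup>2 * G x))"
        unfolding tw h_def right_diff_distrib by (simp only: mult.left_commute)
      then show "cmod (twisted (wr_increment f \<psi>) s h x - complex_of_real r * h x) \<le> C * (\<bar>s\<bar> ^ 3 + s ^ 4)"
        using GC[OF x, of s] by (simp only: norm_mult norm_exp_i_times mult_1_left r_def)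
    qed
    have h1: "cmod (h x - 1) \<le> B" if "x \<in> E" for x
    proof -
      have "h x - 1 = (iexp (s * P F x) - 1) + iexp (s * P F x) * complex_of_real (s\<^sup>2 * G x)"
        by (simp add: h_def distrib_left)
      also have "cmod \<dots> \<le> \<bar>s * P F x\<bar> + \<bar>s\<^sup>2 * G x\<bar>"
        by (rule order_trans[OF norm_triangle_ineq], rule add_mono[OF norm_iexp_minus_one])
           (simp only: norm_mult norm_exp_i_times mult_1_left norm_of_real order_refl)
      also have "\<dots> \<le> B"
        unfolding B_def abs_mult abs_power2 by (intro add_mono mult_left_mono M L that) simp_all
      finally show ?thesis .
    qed
    have 2: "cmod (?\<Phi> k h - ?\<Phi> k (\<lambda>_. 1)) \<le> B" for k
      unfolding path_expectation_diff[OF \<nu>, symmetric] by (rule norm_path_expectation_le[OF \<nu> h1])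
    have 3: "?\<Phi> 0 (\<lambda>_. 1) = 1" by (simp add: path_expectation_def path_sum_def)
    have 4: "cmod (complex_of_real r ^ n * (?\<Phi> 0 h - 1)) \<le> 1 * B"
      unfolding norm_mult norm_power using 2[of 0] r unfolding 3
      by (intro mult_mono power_le_one) simp_all
    have "?\<Phi> n (\<lambda>_. 1) - complex_of_real (r ^ n)
        = ((?\<Phi> n h - complex_of_real r ^ n * ?\<Phi> 0 h) - (?\<Phi> n h - ?\<Phi> n (\<lambda>_. 1))) + complex_of_real r ^ n * (?\<Phi> 0 h - 1)"
      by (simp add: right_diff_distrib)
    also have "cmod \<dots> \<le> (n * (C * (\<bar>s\<bar> ^ 3 + s ^ 4)) + B) + 1 * B"
      by (rule order_trans[OF norm_triangle_ineq], rule add_mono[OF _ 4],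
          rule order_trans[OF norm_triangle_ineq4], rule add_mono[OF 1 2])
    also have "\<dots> = C * (n * (\<bar>s\<bar> ^ 3 + s ^ 4)) + 2 * M * \<bar>s\<bar> + 2 * L * s\<^sup>2"
      by (simp add: B_def)
    also have "\<dots> \<le> (C + 2 * M + 2 * L) * (n * (\<bar>s\<bar> ^ 3 + s ^ 4))
        + (C + 2 * M + 2 * L) * \<bar>s\<bar> + (C + 2 * M + 2 * L) * s\<^sup>2"
      using M(1) L(1) \<open>0 \<le> C\<close> by (intro add_mono mult_right_mono) simp_all
    also have "\<dots> = (C + 2 * M + 2 * L) * (n * (\<bar>s\<bar> ^ 3 + s ^ 4) + (\<bar>s\<bar> + s\<^sup>2))"
      by (simp only: distrib_left add.assoc)
    finally show "cmod (?\<Phi> n (\<lambda>_. 1) - complex_of_real ((1 - s\<^sup>2 * v / 2) ^ n))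
        \<le> (C + 2 * M + 2 * L) * (n * (\<bar>s\<bar> ^ 3 + s ^ 4) + (\<bar>s\<bar> + s\<^sup>2))"
      by (simp only: r_def)
  qed
qed

text \<open>At s = t / sqrt n the accumulated error n |s|^3 is of order 1 / sqrt n, while the power
  of the eigenvalue, (1 - t^2 v / (2 n))^n, tends to the Gaussian characteristic function.\<close>

theorem wr_central_limit:
  assumes F: "\<And>x. x \<in> E \<Longrightarrow> F x - P F x = f x - avg f"
  shows "is_wr_variance E \<pi> Q \<rho> f \<psi> (wr_variance F \<psi>)"
  unfolding is_wr_variance_def
proof (intro conjI allI impI)
  let ?v = "wr_variance F \<psi>"
  show v: "0 \<le> ?v" by (rule wr_variance_nonneg)
  fix \<nu> assume \<nu>: "set_pmf \<nu> \<subseteq> E"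
  show "weak_conv_m
      (\<lambda>n. distr (measure_pmf (mh_chain \<nu> Q \<rho> n)) borel
             (\<lambda>\<omega>. sqrt (real n) * (wr_estimator \<rho> f \<psi> n \<omega> - avg f)))
      (distr std_normal_distribution borel (\<lambda>z. sqrt ?v * z))"
  proof (rule levy_continuity)
    fix t :: real
    let ?\<Phi> = "\<lambda>n. path_expectation \<nu> (wr_increment f \<psi>) (t / sqrt n) n (\<lambda>_. 1)"
    let ?q = "\<lambda>n. 1 / sqrt (real n)"
    obtain C where C: "\<And>\<nu> s n. set_pmf \<nu> \<subseteq> E \<Longrightarrow> s\<^sup>2 * ?v / 2 \<le> 1 \<Longrightarrow>
      cmod (path_expectation \<nu> (wr_increment f \<psi>) s n (\<lambda>_. 1) - complex_of_real ((1 - s\<^sup>2 * ?v / 2) ^ n))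
        \<le> C * (n * (\<bar>s\<bar> ^ 3 + s ^ 4) + (\<bar>s\<bar> + s\<^sup>2))"
      by (rule path_expectation_approx[of F f \<psi>], erule F, rule that)
    have q: "?q \<longlonglongrightarrow> 0" by real_asymp
    have sq: "(t / sqrt (real n))\<^sup>2 = t\<^sup>2 / n" for n by (simp add: power_divide)
    have "(\<lambda>n. (t\<^sup>2 * ?v / 2) / real n) \<longlonglongrightarrow> 0" by (rule lim_const_over_n)
    then have "\<forall>\<^sub>F n in sequentially. (t\<^sup>2 * ?v / 2) / real n < 1"
      by (rule order_tendstoD) simp
    then have small: "\<forall>\<^sub>F n in sequentially. (t / sqrt (real n))\<^sup>2 * ?v / 2 \<le> 1"
      by eventually_elim (simp add: sq)
    have rate: "real n * (\<bar>t / sqrt n\<bar> ^ 3 + (t / sqrt n) ^ 4) + (\<bar>t / sqrt n\<bar> + (t / sqrt n)\<^sup>2)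
        = (\<bar>t\<bar> ^ 3 * ?q n + t ^ 4 * (?q n)\<^sup>2) + (\<bar>t\<bar> * ?q n + t\<^sup>2 * (?q n)\<^sup>2)" if "n > 0" for n
    proof -
      define u where "u = ?q n"
      have u: "0 < u" "real n * (u * u) = 1"
        using that by (simp_all add: u_def)
      have ts: "t / sqrt n = t * u" by (simp add: u_def)
      have "real n * ((\<bar>t\<bar> * u) ^ 3 + (t * u) ^ 4) = (real n * (u * u)) * (\<bar>t\<bar> ^ 3 * u + t ^ 4 * u\<^sup>2)"
        by (simp add: power_mult_distrib power3_eq_cube power4_eq_xxxx power2_eq_square distrib_left mult_ac)
      then show ?thesis
        unfolding ts u_def[symmetric] using u by (simp add: abs_mult power_mult_distrib)
    qed
    have "(\<lambda>n. C * ((\<bar>t\<bar> ^ 3 * ?q n + t ^ 4 * (?q n)\<^sup>2) + (\<bar>t\<bar> * ?q n + t\<^sup>2 * (?q n)\<^sup>2))) \<longlonglongrightarrow>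
        C * ((\<bar>t\<bar> ^ 3 * 0 + t ^ 4 * 0\<^sup>2) + (\<bar>t\<bar> * 0 + t\<^sup>2 * 0\<^sup>2))"
      by (intro tendsto_intros q)
    then have lim: "(\<lambda>n. C * ((\<bar>t\<bar> ^ 3 * ?q n + t ^ 4 * (?q n)\<^sup>2) + (\<bar>t\<bar> * ?q n + t\<^sup>2 * (?q n)\<^sup>2))) \<longlonglongrightarrow> 0"
      by simp
    have "(\<lambda>n. ?\<Phi> n - complex_of_real ((1 - (t / sqrt n)\<^sup>2 * ?v / 2) ^ n)) \<longlonglongrightarrow> 0"
    proof (rule Lim_null_comparison[OF _ lim])
      show "\<forall>\<^sub>F n in sequentially. cmod (?\<Phi> n - complex_of_real ((1 - (t / sqrt n)\<^sup>2 * ?v / 2) ^ n))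
          \<le> C * ((\<bar>t\<bar> ^ 3 * ?q n + t ^ 4 * (?q n)\<^sup>2) + (\<bar>t\<bar> * ?q n + t\<^sup>2 * (?q n)\<^sup>2))"
        using small eventually_gt_at_top[of 0]
      proof eventually_elim
        case (elim n)
        show ?case using C[OF \<nu> elim(1), of n] unfolding rate[OF elim(2)] .
      qed
    qed
    moreover have "(\<lambda>n. complex_of_real ((1 - (t / sqrt n)\<^sup>2 * ?v / 2) ^ n)) \<longlonglongrightarrow> complex_of_real (exp (- (t\<^sup>2 * ?v / 2)))"
    proof (rule tendsto_of_real)
      have "(\<lambda>n. (1 - (t / sqrt n)\<^sup>2 * ?v / 2) ^ n) = (\<lambda>n. (1 + (- (t\<^sup>2 * ?v / 2)) / real n) ^ n)"
        by (simp add: sq mult.commute)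
      then show "(\<lambda>n. (1 - (t / sqrt n)\<^sup>2 * ?v / 2) ^ n) \<longlonglongrightarrow> exp (- (t\<^sup>2 * ?v / 2))"
        by (simp only: tendsto_exp_limit_sequentially)
    qed
    ultimately have "?\<Phi> \<longlonglongrightarrow> complex_of_real (exp (- (t\<^sup>2 * ?v / 2)))"
      by (rule Lim_transform[rotated])
    moreover have "\<forall>\<^sub>F n in sequentially. ?\<Phi> n = char (distr (measure_pmf (mh_chain \<nu> Q \<rho> n)) borel
             (\<lambda>\<omega>. sqrt (real n) * (wr_estimator \<rho> f \<psi> n \<omega> - avg f))) t"
      using eventually_gt_at_top[of 0] by eventually_elim (rule char_wr_estimator[symmetric])
    ultimately show "(\<lambda>n. char (distr (measure_pmf (mh_chain \<nu> Q \<rho> n)) borel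
             (\<lambda>\<omega>. sqrt (real n) * (wr_estimator \<rho> f \<psi> n \<omega> - avg f))) t)
       \<longlonglongrightarrow> char (distr std_normal_distribution borel (\<lambda>z. sqrt ?v * z)) t"
      unfolding char_scaled_std_normal[OF v] by (rule Lim_transform_eventually)
  qed (simp_all add: real_distribution_scaled_std_normal prob_space.real_distribution_distr[OF measure_pmf.prob_space_axioms])
qed

text \<open>Started from \<pi>, the characteristic functions at t = 1 converge to exp (- v / 2),
  which determines v.\<close>

lemma is_wr_variance_unique:
  assumes "is_wr_variance E \<pi> Q \<rho> f \<psi> v" "is_wr_variance E \<pi> Q \<rho> f \<psi> v'"
  shows "v = v'"
proof -
  have lim: "(\<lambda>n. char (distr (measure_pmf (mh_chain \<pi> Q \<rho> n)) borel
             (\<lambda>\<omega>. sqrt (real n) * (wr_estimator \<rho> f \<psi> n \<omega> - avg f))) 1) \<longlonglongrightarrow> complex_of_real (exp (- (1\<^sup>2 * u / 2)))"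
    if u: "is_wr_variance E \<pi> Q \<rho> f \<psi> u" for u
  proof -
    have "0 \<le> u" and conv: "weak_conv_m
        (\<lambda>n. distr (measure_pmf (mh_chain \<pi> Q \<rho> n)) borel
               (\<lambda>\<omega>. sqrt (real n) * (wr_estimator \<rho> f \<psi> n \<omega> - avg f)))
        (distr std_normal_distribution borel (\<lambda>z. sqrt u * z))"
      using u set_pi unfolding is_wr_variance_def by auto
    show ?thesis
      unfolding char_scaled_std_normal[OF \<open>0 \<le> u\<close>, symmetric]
      by (rule levy_continuity1[OF _ _ conv])
         (simp_all add: real_distribution_scaled_std_normal prob_space.real_distribution_distr[OF measure_pmf.prob_space_axioms])
  qed
  have "complex_of_real (exp (- (1\<^sup>2 * v / 2))) = complex_of_real (exp (- (1\<^sup>2 * v' / 2)))"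
    by (rule LIMSEQ_unique[OF lim[OF assms(1)] lim[OF assms(2)]])
  then show ?thesis by (simp only: of_real_eq_iff exp_inj_iff) simp
qed

text \<open>This replaces the variance defined through a limit law by a closed formula; the two
  acceptance rules are then compared by algebra alone.\<close>

theorem wr_sigma2_eq:
  fixes f \<psi> :: "'a \<Rightarrow> real"
  defines "F \<equiv> poisson_solution E \<pi> Q \<rho> f"
  shows "wr_sigma2 E \<pi> Q \<rho> f \<psi>
    = sigma2 E \<pi> Q \<rho> f - rejection_form F + rejection_form (\<lambda>x. \<psi> x - F x)"
proof -
  have "wr_sigma2 E \<pi> Q \<rho> f \<psi> = wr_variance F \<psi>"
    unfolding wr_sigma2_def
    by (intro the_equality is_wr_variance_unique[OF _ wr_central_limit] wr_central_limit)
       (simp_all add: F_def poisson_solution)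
  then show ?thesis
    by (simp add: wr_variance_eq sigma2_def F_def Let_def)
qed

end

section \<open>Barker-type acceptance\<close>

locale barker = mh E \<pi> Q \<rho>
  for E :: "'a set" and \<pi> :: "'a pmf" and Q :: "'a \<Rightarrow> 'a pmf" and \<rho> :: "'a \<Rightarrow> 'a \<Rightarrow> real" +
  fixes \<alpha> :: real
  assumes alpha_pos: "0 < \<alpha>" and alpha_less_2: "\<alpha> < 2"
    and acceptance: "acceptance_given_by (\<lambda>u. \<alpha> * u / (1 + u)) E \<pi> Q \<rho>"
begin

text \<open>With a and b the proposal fluxes of the two directions of an edge, the argument of the
  acceptance function is b / a. Hence \<rho> is \<alpha> b / (a + b), and the accepted flux is
  \<alpha> / 2 times the harmonic mean of a and b.\<close>

definition proposal_flux :: "'a \<Rightarrow> 'a \<Rightarrow> real" where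
  "proposal_flux x y = pmf \<pi> x * pmf (Q x) y"

lemma proposal_flux_nonneg: "0 \<le> proposal_flux x y"
  by (simp add: proposal_flux_def)

lemma flux_zero:
  assumes "x \<in> E" "y \<in> E" "pmf (Q x) y = 0"
  shows "flux x y = 0" "flux y x = 0" "proposal_flux x y = 0" "proposal_flux y x = 0"
  using assms Q_zero_sym[OF assms(1,2)] by (simp_all add: flux_def proposal_flux_def)

lemma rho_barker:
  assumes "x \<in> E" "y \<in> E" "pmf (Q x) y \<noteq> 0"
  shows "\<rho> x y = \<alpha> * proposal_flux y x / (proposal_flux x y + proposal_flux y x)"
    and "0 < proposal_flux x y" "0 < proposal_flux y x"
proof -
  have "pmf (Q y) x \<noteq> 0" using assms Q_zero_sym by blast
  then have "0 < pmf (Q x) y" "0 < pmf (Q y) x"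
    using assms(3) pmf_nonneg[of "Q x" y] pmf_nonneg[of "Q y" x] by linarith+
  then show ab: "0 < proposal_flux x y" "0 < proposal_flux y x"
    using assms by (simp_all add: proposal_flux_def pi_pos)
  have "\<rho> x y = \<alpha> * (proposal_flux y x / proposal_flux x y) / (1 + proposal_flux y x / proposal_flux x y)"
    using acceptance assms \<open>0 < pmf (Q x) y\<close> unfolding acceptance_given_by_def proposal_flux_def by blast
  also have "\<dots> = \<alpha> * proposal_flux y x / (proposal_flux x y + proposal_flux y x)"
    using ab by (simp add: field_simps)
  finally show "\<rho> x y = \<alpha> * proposal_flux y x / (proposal_flux x y + proposal_flux y x)" .
qed

lemma flux_barker:
  assumes "x \<in> E" "y \<in> E"
  shows "flux x y = \<alpha> * (proposal_flux x y * proposal_flux y x) / (proposal_flux x y + proposal_flux y x)"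
proof (cases "pmf (Q x) y = 0")
  case True
  \<comment> \<open>Both proposal fluxes are 0, and the quotient 0 / 0 has the value 0.\<close>
  then show ?thesis using flux_zero[OF assms] by simp
next
  case False
  then show ?thesis
    using rho_barker(1)[OF assms] by (simp add: flux_def proposal_flux_def mult_ac)
qed

text \<open>The two acceptance probabilities of an edge add up to \<alpha> (a + b) / (a + b) =
  \<alpha>, and the flux is symmetric.\<close>

lemma rejection_flux_barker:
  assumes "x \<in> E" "y \<in> E"
  shows "flux x y * (1 - \<rho> x y) + flux y x * (1 - \<rho> y x) = (2 - \<alpha>) * flux x y"
proof (cases "pmf (Q x) y = 0")
  case True
  then show ?thesis using flux_zero[OF assms] by simp
next
  case False
  then have nz: "pmf (Q y) x \<noteq> 0" using assms Q_zero_sym by blast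
  let ?a = "proposal_flux x y" and ?b = "proposal_flux y x"
  have "\<rho> x y + \<rho> y x = \<alpha> * ?b / (?a + ?b) + \<alpha> * ?a / (?a + ?b)"
    using rho_barker(1)[OF assms False] rho_barker(1)[OF assms(2,1) nz] by (simp add: add.commute)
  also have "\<dots> = \<alpha>"
  proof -
    have "?a + ?b \<noteq> 0" using rho_barker(2,3)[OF assms False] by simp
    then show ?thesis
      unfolding add_divide_distrib[symmetric] distrib_left[symmetric] add.commute[of ?b ?a] by simp
  qed
  finally have "\<rho> y x = \<alpha> - \<rho> x y" by simp
  then show ?thesis
    unfolding flux_sym[OF assms(2,1)] by (simp only:) (simp add: algebra_simps)
qed

lemma rejection_form_barker: "rejection_form g = (2 - \<alpha>) * dirichlet g g"
proof -
  have "rejection_form g = (\<Sum>y\<in>E. \<Sum>x\<in>E. flux x y * (1 - \<rho> x y) * (g y - g x)\<^sup>2)"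
    unfolding rejection_form_def by (rule sum.swap)
  then have "2 * rejection_form g
      = (\<Sum>x\<in>E. \<Sum>y\<in>E. flux x y * (1 - \<rho> x y) * (g y - g x)\<^sup>2 + flux y x * (1 - \<rho> y x) * (g x - g y)\<^sup>2)"
    unfolding sum.distrib by (simp add: rejection_form_def)
  also have "\<dots> = (\<Sum>x\<in>E. \<Sum>y\<in>E. (2 - \<alpha>) * (flux x y * (g x - g y) * (g x - g y)))"
  proof (intro sum.cong refl)
    fix x y assume "x \<in> E" "y \<in> E"
    have "flux x y * (1 - \<rho> x y) * (g y - g x)\<^sup>2 + flux y x * (1 - \<rho> y x) * (g x - g y)\<^sup>2
        = (flux x y * (1 - \<rho> x y) + flux y x * (1 - \<rho> y x)) * (g x - g y)\<^sup>2"
      by (simp only: power2_commute[of "g y"] distrib_right)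
    then show "flux x y * (1 - \<rho> x y) * (g y - g x)\<^sup>2 + flux y x * (1 - \<rho> y x) * (g x - g y)\<^sup>2
        = (2 - \<alpha>) * (flux x y * (g x - g y) * (g x - g y))"
      unfolding rejection_flux_barker[OF \<open>x \<in> E\<close> \<open>y \<in> E\<close>] by (simp add: power2_eq_square mult.assoc)
  qed
  also have "\<dots> = 2 * ((2 - \<alpha>) * dirichlet g g)"
    by (simp add: dirichlet_def sum_distrib_left[symmetric])
  finally show ?thesis by simp
qed

section \<open>Variance against energy, and the quadratic polynomial in b\<close>

definition variance_pi :: "('a \<Rightarrow> real) \<Rightarrow> real" where
  "variance_pi f = avg (\<lambda>x. (f x)\<^sup>2) - (avg f)\<^sup>2"

lemma variance_pi_centered: "variance_pi f = avg (\<lambda>x. (f x - avg f)\<^sup>2)"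
proof -
  have "avg (\<lambda>x. (f x - avg f)\<^sup>2) = avg (\<lambda>x. (f x)\<^sup>2 - (2 * avg f) * f x + (avg f)\<^sup>2)"
    by (simp add: power2_diff algebra_simps)
  also have "\<dots> = variance_pi f"
    unfolding mean_add mean_diff mean_cmult mean_const by (simp add: variance_pi_def power2_eq_square)
  finally show ?thesis ..
qed

lemma variance_pi_nonneg: "0 \<le> variance_pi f"
  unfolding variance_pi_centered mean_def by (intro sum_nonneg mult_nonneg_nonneg) auto

text \<open>Since F - P F is the centred f, the mixed energy is the covariance of f with itself.
  This removes F from the coefficient of b.\<close>

lemma dirichlet_poisson:
  "dirichlet f (poisson_solution E \<pi> Q \<rho> f) = variance_pi f"
proof -
  have "dirichlet f (poisson_solution E \<pi> Q \<rho> f) = avg (\<lambda>x. f x * f x - avg f * f x)"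
    unfolding mean_generator[symmetric]
    by (rule mean_cong) (simp add: poisson_solution right_diff_distrib)
  also have "\<dots> = variance_pi f"
    unfolding mean_diff mean_cmult by (simp add: variance_pi_def power2_eq_square)
  finally show ?thesis .
qed

lemma dirichlet_cmult_diff:
  "dirichlet (\<lambda>x. b * f x - F x) (\<lambda>x. b * f x - F x)
    = b\<^sup>2 * dirichlet f f - 2 * b * dirichlet f F + dirichlet F F"
proof -
  have "(\<Sum>x\<in>E. \<Sum>y\<in>E. flux x y * (b * f x - F x - (b * f y - F y)) * (b * f x - F x - (b * f y - F y)))
      = (\<Sum>x\<in>E. \<Sum>y\<in>E. b\<^sup>2 * (flux x y * (f x - f y) * (f x - f y))
          - 2 * b * (flux x y * (f x - f y) * (F x - F y)) + flux x y * (F x - F y) * (F x - F y))"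
    by (intro sum.cong refl) (simp add: power2_eq_square algebra_simps)
  then show ?thesis
    unfolding dirichlet_def sum.distrib sum_subtractf sum_distrib_left[symmetric]
    by (simp add: field_simps)
qed

text \<open>The energy of F cancels between the two rejection forms, so F survives only in the
  constant term.\<close>

lemma wr_sigma2_barker:
  "wr_sigma2 E \<pi> Q \<rho> f (\<lambda>x. b * f x)
    = sigma2 E \<pi> Q \<rho> f + (2 - \<alpha>) * (b\<^sup>2 * dirichlet f f - 2 * b * variance_pi f)"
  unfolding wr_sigma2_eq rejection_form_barker dirichlet_cmult_diff dirichlet_poisson
  by (simp add: algebra_simps)

text \<open>Cauchy--Schwarz in the form \<open>a b (u - w)\<^sup>2 \<le> (a + b) (a u\<^sup>2 + b w\<^sup>2)\<close>, whose defect is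
  \<open>(a u + b w)\<^sup>2\<close>.\<close>

lemma flux_square_defect:
  assumes "x \<in> E" "y \<in> E"
  shows "\<alpha> * (proposal_flux x y * u\<^sup>2 + proposal_flux y x * w\<^sup>2) - flux x y * (u - w)\<^sup>2
    = \<alpha> * (proposal_flux x y * u + proposal_flux y x * w)\<^sup>2 / (proposal_flux x y + proposal_flux y x)"
proof (cases "pmf (Q x) y = 0")
  case True
  then show ?thesis using flux_zero[OF assms] by simp
next
  case False
  let ?a = "proposal_flux x y" and ?b = "proposal_flux y x"
  have "?a + ?b \<noteq> 0" using rho_barker(2,3)[OF assms False] by simp
  moreover have "\<alpha> * (?a * u\<^sup>2 + ?b * w\<^sup>2) * (?a + ?b) - \<alpha> * (?a * ?b) * (u - w)\<^sup>2 = \<alpha> * (?a * u + ?b * w)\<^sup>2"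
    by (simp add: power2_eq_square algebra_simps)
  ultimately show ?thesis
    unfolding flux_barker[OF assms] by (simp add: divide_simps)
qed

lemma variance_pi_proposal:
  "2 * variance_pi f = (\<Sum>x\<in>E. \<Sum>y\<in>E. proposal_flux x y * (f x - avg f)\<^sup>2 + proposal_flux y x * (f y - avg f)\<^sup>2)"
proof -
  have 1: "(\<Sum>x\<in>E. \<Sum>y\<in>E. proposal_flux x y * (f x - avg f)\<^sup>2) = variance_pi f"
    unfolding variance_pi_centered mean_def proposal_flux_def
    by (intro sum.cong refl) (simp add: sum_distrib_right[symmetric] sum_distrib_left[symmetric] sum_Q)
  have "(\<Sum>x\<in>E. \<Sum>y\<in>E. proposal_flux y x * (f y - avg f)\<^sup>2) = variance_pi f"
    unfolding 1[symmetric] by (rule sum.swap)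
  then show ?thesis unfolding sum.distrib 1 by simp
qed

text \<open>The edgewise defects are summed with u and w the centred values of f, which is allowed
  because energies see differences only. Having the defect as an explicit sum of nonnegative terms
  settles both the inequality and its equality case.\<close>

lemma dirichlet_defect:
  "2 * (\<alpha> * variance_pi f - dirichlet f f)
    = (\<Sum>x\<in>E. \<Sum>y\<in>E. \<alpha> * (proposal_flux x y * (f x - avg f) + proposal_flux y x * (f y - avg f))\<^sup>2
        / (proposal_flux x y + proposal_flux y x))"
proof -
  have "2 * (\<alpha> * variance_pi f - dirichlet f f) = \<alpha> * (2 * variance_pi f) - 2 * dirichlet f f"
    by simp
  also have "\<dots> = (\<Sum>x\<in>E. \<Sum>y\<in>E.
      \<alpha> * (proposal_flux x y * (f x - avg f)\<^sup>2 + proposal_flux y x * (f y - avg f)\<^sup>2)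
      - flux x y * (f x - f y) * (f x - f y))"
    unfolding variance_pi_proposal dirichlet_def sum_subtractf sum_distrib_left[symmetric] by simp
  also have "\<dots> = (\<Sum>x\<in>E. \<Sum>y\<in>E. \<alpha> * (proposal_flux x y * (f x - avg f) + proposal_flux y x * (f y - avg f))\<^sup>2
        / (proposal_flux x y + proposal_flux y x))"
    by (intro sum.cong refl, subst flux_square_defect[symmetric])
       (simp_all add: power2_eq_square mult.assoc)
  finally show ?thesis .
qed

lemma dirichlet_le: "dirichlet f f \<le> \<alpha> * variance_pi f"
proof -
  have "0 \<le> 2 * (\<alpha> * variance_pi f - dirichlet f f)"
    unfolding dirichlet_defect using alpha_pos proposal_flux_nonneg
    by (intro sum_nonneg divide_nonneg_nonneg) (auto intro: add_nonneg_nonneg)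
  then show ?thesis by simp
qed

text \<open>Equality makes every edge defect vanish, that is a u + b w = 0, so the flow a b / (a +
  b) (u - w) equals a u. Summing over y turns the generator of the chain into that of independent
  sampling from \<pi>.\<close>

lemma dirichlet_eq_imp_constant_mh_op:
  assumes "dirichlet f f = \<alpha> * variance_pi f" "\<alpha> = 1" "x \<in> E"
  shows "P f x = avg f"
proof -
  let ?q = proposal_flux
  let ?d = "\<lambda>x y. \<alpha> * (?q x y * (f x - avg f) + ?q y x * (f y - avg f))\<^sup>2 / (?q x y + ?q y x)"
  have nn: "0 \<le> ?d x y" for x y
    using alpha_pos proposal_flux_nonneg[of x y] proposal_flux_nonneg[of y x]
    by (intro divide_nonneg_nonneg) auto
  have "(\<Sum>x\<in>E. \<Sum>y\<in>E. ?d x y) = 0"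
    unfolding dirichlet_defect[symmetric] using assms(1) by simp
  then have d0: "?d x y = 0" if "y \<in> E" for y
    using that assms(3) nn by (auto simp add: sum_nonneg_eq_0_iff sum_nonneg)
  have "flux x y * (f x - f y) = ?q x y * (f x - avg f)" if y: "y \<in> E" for y
  proof (cases "pmf (Q x) y = 0")
    case True
    then show ?thesis using flux_zero[OF assms(3) y] by simp
  next
    case False
    define a b u w where "a = ?q x y" "b = ?q y x" "u = f x - avg f" "w = f y - avg f"
    have ab: "a + b \<noteq> 0" using rho_barker(2,3)[OF assms(3) y False] by (simp add: a_b_u_w_def)
    have "a * u + b * w = 0"
      using d0[OF y] ab alpha_pos by (simp add: a_b_u_w_def)
    then have "b * w = - (a * u)" by simp
    have "a * b * (u - w) = a * (b * u) - a * (b * w)" by (simp add: algebra_simps)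
    also have "\<dots> = a * u * (a + b)"
      unfolding \<open>b * w = - (a * u)\<close> by (simp add: algebra_simps)
    finally have "a * b / (a + b) * (u - w) = a * u"
      using ab by (simp add: field_simps)
    moreover have "flux x y = a * b / (a + b)"
      using flux_barker[OF assms(3) y] assms(2) by (simp add: a_b_u_w_def)
    ultimately show ?thesis by (simp add: a_b_u_w_def)
  qed
  then have "pmf \<pi> x * (f x - P f x) = (\<Sum>y\<in>E. ?q x y * (f x - avg f))"
    unfolding pi_generator[OF assms(3)] by (intro sum.cong refl)
  also have "\<dots> = pmf \<pi> x * (f x - avg f)"
    by (simp add: proposal_flux_def sum_distrib_right[symmetric] sum_distrib_left[symmetric] sum_Q[OF assms(3)])
  finally show ?thesis using pi_pos[OF assms(3)] by simp
qed

text \<open>As P f is constant, F^2 - (P F)^2 equals 2 F (f - P f) - (f - <\<pi>,f>)^2, whose mean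
  is 2 Var f - Var f. With energy equal to Var f, the quadratic at b = 1 is Var f + (Var f - 2 Var
  f) = 0.\<close>

lemma dirichlet_eq_imp_zero_variance:
  assumes "dirichlet f f = \<alpha> * variance_pi f" "\<alpha> = 1"
  shows "wr_sigma2 E \<pi> Q \<rho> f f = 0"
proof -
  define F where "F = poisson_solution E \<pi> Q \<rho> f"
  have F: "F x - P F x = f x - avg f" if "x \<in> E" for x
    unfolding F_def by (rule poisson_solution[OF that])
  have "sigma2 E \<pi> Q \<rho> f = avg (\<lambda>x. (F x)\<^sup>2 - (P F x)\<^sup>2)"
    by (simp add: sigma2_def F_def Let_def mean_diff)
  also have "\<dots> = avg (\<lambda>x. 2 * (F x * (f x - P f x)) - (f x - avg f)\<^sup>2)"
  proof (rule mean_cong)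
    fix x assume x: "x \<in> E"
    have PF: "P F x = F x - (f x - avg f)" using F[OF x] by simp
    show "(F x)\<^sup>2 - (P F x)\<^sup>2 = 2 * (F x * (f x - P f x)) - (f x - avg f)\<^sup>2"
      unfolding PF dirichlet_eq_imp_constant_mh_op[OF assms x]
      by (simp add: power2_eq_square algebra_simps)
  qed
  also have "\<dots> = 2 * dirichlet F f - variance_pi f"
    unfolding mean_diff mean_cmult mean_generator variance_pi_centered ..
  also have "dirichlet F f = variance_pi f"
    unfolding F_def dirichlet_commute[of _ f] by (rule dirichlet_poisson)
  finally show ?thesis
    using wr_sigma2_barker[of f 1] assms by simp
qed

text \<open>At b = 1 the claim is that the energy is at most 2 Var f, which follows from the bound
  \<alpha> Var f.\<close>

lemma wr_sigma2_le_sigma2: "wr_sigma2 E \<pi> Q \<rho> f f \<le> sigma2 E \<pi> Q \<rho> f"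
proof -
  have "dirichlet f f \<le> 2 * variance_pi f"
    using dirichlet_le[of f] mult_right_mono[OF less_imp_le[OF alpha_less_2] variance_pi_nonneg[of f]]
    by linarith
  then have "0 \<le> (2 - \<alpha>) * (2 * variance_pi f - dirichlet f f)"
    using alpha_less_2 by (intro mult_nonneg_nonneg) simp_all
  then show ?thesis
    using wr_sigma2_barker[of f 1] by (simp add: algebra_simps)
qed

context
  fixes f :: "'a \<Rightarrow> real" and b_star :: real
  assumes nonconst: "\<not> (\<exists>c. \<forall>x\<in>E. f x = c)"
  defines "b_star \<equiv> (avg (\<lambda>x. (f x)\<^sup>2) - (avg f)\<^sup>2) / avg (\<lambda>x. (f x)\<^sup>2 - f x * P f x)"
begin

lemma dirichlet_pos: "0 < dirichlet f f"
proof (rule ccontr)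
  assume "\<not> 0 < dirichlet f f"
  then have "dirichlet f f = 0" using dirichlet_nonneg[of f] by simp
  then have "\<forall>x\<in>E. f x = f y" if "y \<in> E" for y
    using dirichlet_zero_imp_constant that by blast
  then show False using nonconst E_nonempty by blast
qed

lemma b_star_eq: "b_star = variance_pi f / dirichlet f f"
proof -
  have "avg (\<lambda>x. (f x)\<^sup>2 - f x * P f x) = dirichlet f f"
    unfolding mean_generator[symmetric] by (simp add: power2_eq_square right_diff_distrib)
  then show ?thesis by (simp add: b_star_def variance_pi_def)
qed

text \<open>Completing the square: the excess over the value at \<open>b_star\<close> is (2 -
  \<alpha>) times the energy of f times (b - b_star)^2.\<close>

lemma b_star_minimal:
  "wr_sigma2 E \<pi> Q \<rho> f (\<lambda>x. b_star * f x) \<le> wr_sigma2 E \<pi> Q \<rho> f (\<lambda>x. b * f x)"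
proof -
  have V: "variance_pi f = b_star * dirichlet f f"
    using dirichlet_pos by (simp add: b_star_eq)
  have "(b\<^sup>2 * dirichlet f f - 2 * b * variance_pi f) - (b_star\<^sup>2 * dirichlet f f - 2 * b_star * variance_pi f)
      = dirichlet f f * (b - b_star)\<^sup>2"
    unfolding V by (simp add: power2_eq_square algebra_simps)
  also have "\<dots> \<ge> 0" using dirichlet_pos by simp
  finally show ?thesis
    unfolding wr_sigma2_barker using alpha_less_2 by (intro add_left_mono mult_left_mono) simp_all
qed

lemma b_star_ge: "1 / \<alpha> \<le> b_star"
  unfolding b_star_eq using dirichlet_pos alpha_pos dirichlet_le[of f]
  by (simp add: divide_simps mult.commute)

lemma b_star_gt_1:
  assumes "\<alpha> = 1" "0 < wr_sigma2 E \<pi> Q \<rho> f f"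
  shows "1 < b_star"
proof -
  have "dirichlet f f \<noteq> \<alpha> * variance_pi f"
    using dirichlet_eq_imp_zero_variance assms by fastforce
  then have "dirichlet f f < variance_pi f"
    using dirichlet_le[of f] assms(1) by simp
  then show ?thesis
    unfolding b_star_eq using dirichlet_pos by simp
qed

end

end

section \<open>A Metropolis counterexample\<close>

text \<open>The random walk on the path \<open>0 - 1 - 2\<close>, where only the edge \<open>0 - 1\<close> is proposed
  asymmetrically.  For the solution \<open>F = (0, 0, 1)\<close> of the Poisson equation of \<open>f\<close> the rejection form,
  which only sees that edge, vanishes at \<open>F\<close> but not at \<open>f - F\<close>.\<close>

definition path_proposal :: "nat \<Rightarrow> nat pmf" where
  "path_proposal x = (if x = 0 then return_pmf 1 else if x = 1 then pmf_of_set {0, 2} else pmf_of_set {1, 2})"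

text \<open>The Metropolis rule for uniform \<pi>: the ratio of proposal probabilities is 1/2 for
  the move from 0 to 1, 2 for its reversal, and 1 for the other possible moves.\<close>

definition path_acceptance :: "nat \<Rightarrow> nat \<Rightarrow> real" where
  "path_acceptance x y = (if x = 0 \<and> y = 1 then 1 / 2 else 1)"

text \<open>Computed as F - P F for F = (0, 0, 1), where P F = (0, 1/2, 1/2).\<close>

definition path_function :: "nat \<Rightarrow> real" where
  "path_function x = (if x = 0 then 0 else if x = 1 then - 1 / 2 else 1 / 2)"

lemma pmf_path_proposal:
  "pmf (path_proposal 0) y = (if y = 1 then 1 else 0)"
  "pmf (path_proposal 1) y = (if y = 0 \<or> y = 2 then 1 / 2 else 0)"
  "pmf (path_proposal (Suc 0)) y = (if y = 0 \<or> y = 2 then 1 / 2 else 0)"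
  "pmf (path_proposal 2) y = (if y = 1 \<or> y = 2 then 1 / 2 else 0)"
  by (simp_all add: path_proposal_def indicator_def)

lemma irreducible_path: "irreducible_on {0, 1, 2} path_proposal"
proof -
  let ?R = "{(u, v). u \<in> {0, 1, 2} \<and> v \<in> {0, 1, 2} \<and> pmf (path_proposal u) v > 0}"
  have e: "(0, 1) \<in> ?R" "(1, 0) \<in> ?R" "(1, 2) \<in> ?R" "(2, 1) \<in> ?R"
    by (simp_all add: pmf_path_proposal)
  have to1: "(x, 1) \<in> ?R\<^sup>*" if "x \<in> {0, 1, 2}" for x
    using that e(1,4) by (auto intro: r_into_rtrancl)
  have from1: "(1, y) \<in> ?R\<^sup>*" if "y \<in> {0, 1, 2}" for y
    using that e(2,3) by (auto intro: r_into_rtrancl)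
  show ?thesis
    unfolding irreducible_on_def by (intro ballI rtrancl_trans[OF to1 from1])
qed

lemma metropolis_hastings_path:
  "metropolis_hastings {0, 1, 2} (pmf_of_set {0, 1, 2}) path_proposal path_acceptance"
proof -
  have "set_pmf (path_proposal x) \<subseteq> {0, 1, 2}" for x
    by (simp add: path_proposal_def)
  then show ?thesis
    unfolding metropolis_hastings_def using irreducible_path
    by (simp add: pmf_path_proposal path_acceptance_def)
qed

lemma acceptance_path:
  "acceptance_given_by (\<lambda>u. min 1 u) {0, 1, 2} (pmf_of_set {0, 1, 2}) path_proposal path_acceptance"
  unfolding acceptance_given_by_def by (simp add: pmf_path_proposal path_acceptance_def)

lemma wr_sigma2_path_greater:
  "sigma2 {0, 1, 2} (pmf_of_set {0, 1, 2}) path_proposal path_acceptance path_function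
   < wr_sigma2 {0, 1, 2} (pmf_of_set {0, 1, 2}) path_proposal path_acceptance path_function path_function"
proof -
  interpret mh "{0, 1, 2}" "pmf_of_set {0, 1, 2}" path_proposal path_acceptance
    by (rule mh.intro) (rule metropolis_hastings_path)
  define F where "F = poisson_solution {0, 1, 2} (pmf_of_set {0, 1, 2}) path_proposal path_acceptance path_function"
  \<comment> \<open>Only the move from 0 to 1 can be rejected; its flux is 1/3 * 1 * 1/2 and its
    rejection probability is 1/2.\<close>
  have form: "rejection_form g = (g 1 - g 0)\<^sup>2 / 12" for g
    unfolding rejection_form_def flux_def by (simp add: pmf_path_proposal path_acceptance_def)
  have mean0: "avg path_function = 0"
    unfolding mean_def by (simp add: path_function_def)
  have P0: "P F 0 = (F 0 + F 1) / 2"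
    by (subst mh_op_eq, simp, simp add: pmf_path_proposal path_acceptance_def)
  \<comment> \<open>The Poisson equation at state 0 is enough: f vanishes there and is centred, and
    from 0 the chain moves only to 1. This forces F 1 = F 0 for the solution picked by the choice
    operator, without computing it.\<close>
  have "F 0 - P F 0 = 0"
    using poisson_solution[of 0 path_function] mean0 by (simp add: F_def path_function_def)
  then have "F 1 = F 0" unfolding P0 by simp
  then have "rejection_form F = 0" and "0 < rejection_form (\<lambda>x. path_function x - F x)"
    unfolding form by (simp_all add: path_function_def)
  then show ?thesis
    unfolding wr_sigma2_eq F_def[symmetric] by simp
qed

theorem proposition2p3:
  shows
   "(\<exists>(E :: nat set) \<pi> Q \<rho> f.
       metropolis_hastings E \<pi> Q \<rho> \<and>
       acceptance_given_by (\<lambda>u. min 1 u) E \<pi> Q \<rho> \<and>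
       wr_sigma2 E \<pi> Q \<rho> f f > sigma2 E \<pi> Q \<rho> f)
    \<and>
    (\<forall>(E :: 'a set) \<pi> Q \<rho> (\<alpha> :: real).
       0 < \<alpha> \<and> \<alpha> < 2 \<and>
       metropolis_hastings E \<pi> Q \<rho> \<and>
       acceptance_given_by (\<lambda>u. \<alpha> * u / (1 + u)) E \<pi> Q \<rho>
       \<longrightarrow>
       (\<forall>f. wr_sigma2 E \<pi> Q \<rho> f f \<le> sigma2 E \<pi> Q \<rho> f) \<and>
       (\<forall>f. \<not> (\<exists>c. \<forall>x\<in>E. f x = c) \<longrightarrow>
          (let b_star = (mean E \<pi> (\<lambda>x. (f x)\<^sup>2) - (mean E \<pi> f)\<^sup>2) /
                        mean E \<pi> (\<lambda>x. (f x)\<^sup>2 - f x * mh_op E Q \<rho> f x)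
           in (\<forall>b. wr_sigma2 E \<pi> Q \<rho> f (\<lambda>x. b_star * f x)
                    \<le> wr_sigma2 E \<pi> Q \<rho> f (\<lambda>x. b * f x)) \<and>
              b_star \<ge> 1 / \<alpha> \<and>
              (\<alpha> = 1 \<and> wr_sigma2 E \<pi> Q \<rho> f f > 0 \<longrightarrow> b_star > 1))))"
  (is "?metropolis \<and> ?barker")
proof
  show ?metropolis
    using metropolis_hastings_path acceptance_path wr_sigma2_path_greater by blast
  show ?barker
  proof (intro allI impI)
    fix E :: "'a set" and \<pi> Q \<rho> and \<alpha> :: real
    assume *: "0 < \<alpha> \<and> \<alpha> < 2 \<and> metropolis_hastings E \<pi> Q \<rho>
      \<and> acceptance_given_by (\<lambda>u. \<alpha> * u / (1 + u)) E \<pi> Q \<rho>"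
    interpret barker E \<pi> Q \<rho> \<alpha>
      by (intro barker.intro mh.intro barker_axioms.intro) (use * in blast)+
    show "(\<forall>f. wr_sigma2 E \<pi> Q \<rho> f f \<le> sigma2 E \<pi> Q \<rho> f) \<and>
       (\<forall>f. \<not> (\<exists>c. \<forall>x\<in>E. f x = c) \<longrightarrow>
          (let b_star = (mean E \<pi> (\<lambda>x. (f x)\<^sup>2) - (mean E \<pi> f)\<^sup>2) /
                        mean E \<pi> (\<lambda>x. (f x)\<^sup>2 - f x * mh_op E Q \<rho> f x)
           in (\<forall>b. wr_sigma2 E \<pi> Q \<rho> f (\<lambda>x. b_star * f x)
                    \<le> wr_sigma2 E \<pi> Q \<rho> f (\<lambda>x. b * f x)) \<and>
              b_star \<ge> 1 / \<alpha> \<and>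
              (\<alpha> = 1 \<and> wr_sigma2 E \<pi> Q \<rho> f f > 0 \<longrightarrow> b_star > 1)))"
      unfolding Let_def
      by (intro conjI allI impI)
         (elim conjE | rule wr_sigma2_le_sigma2 b_star_minimal b_star_ge b_star_gt_1 | assumption)+
  qed
qed

end
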